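(* With the notation below, let $p\in\mathcal P^{(\boldsymbol\alpha)}(\mathbf m)$ be a path of soliton content $\mathbf m=(m_1,\dots,m_N)$ (all $m_j>0$) and symmetry $\boldsymbol\alpha$. Then there is a bijection between the orbit $\mathcal T\cdot p\subset\mathcal P$ and the discrete torus $F^{(\boldsymbol\alpha)}\mathbb Z^N\backslash\mathbb Z^N$ which commutes with the action of $\mathcal T$, where $\sum_kn_kT_k$ acts on $F^{(\boldsymbol\alpha)}\mathbb Z^N\backslash\mathbb Z^N$ by $[\boldsymbol\omega]\mapsto[\boldsymbol\omega+\sum_kn_k\boldsymbol h_k]$ with $\boldsymbol h_k=(\min(j,k))_{1\le j\le N}$.
   Context: Paths: fix $L\ge1$; $\mathcal P$ is the set of words $b_1\cdots b_L$ in letters $1,2$ with $\#1\ge\#2$. $B_k$ ($k\ge1$) is the set of words $1^{k-a}2^a$, $0\le a\le k$. The map $R:B_k\times B_1\to B_1\times B_k$ is: $R(1^k,1)=(1,1^k)$; $R(2^k,2)=(2,2^k)$; $R(1^{k-a}2^a,1)=(2,1^{k-a+1}2^{a-1})$ for $0<a\le k$; $R(1^{k-a}2^a,2)=(1,1^{k-a-1}2^{a+1})$ for $0\le a<k$. For $v\in B_k$ and a path $b_1\cdots b_L$, set $v_0=v$ and $(b'_i,v_i)=R(v_{i-1},b_i)$ for $i=1,\dots,L$. Let $v^*$ be the final $v_L$ obtained starting from $v=1^k$; running again from $v=v^*$ one returns $v_L=v^*$, and one defines $T_k(b_1\cdots b_L)=b'_1\cdots b'_L$ computed from $v=v^*$.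 ($T_1$ is the cyclic shift $b_1\cdots b_L\mapsto b_Lb_1\cdots b_{L-1}$.) The $T_k$ commute and are bijections of $\mathcal P$; $\mathcal T$ is the free abelian group on $T_1,\dots,T_N$ acting on $\mathcal P$ via $\sum n_kT_k\mapsto T_1^{n_1}\cdots T_N^{n_N}$. Ballot sequences: $p_+=b_1\cdots b_L$ is ballot if every prefix has at least as many $1$'s as $2$'s; every $p\in\mathcal P$ equals $T_1^d(p_+)$ for some $d\in\mathbb Z$ and ballot $p_+$. KKR map of a ballot $p_+$: with $b_{L+1}:=1$, let $M_1$ (resp. $M_2$) be the multiset of $j\in\{1,\dots,L\}$ with $b_j=1,b_{j+1}=2$ (resp. $b_j=2,b_{j+1}=1$). $\mathrm{Op}_1$ (resp. $\mathrm{Op}_2$) replaces the $i$-th smallest element $x$ of a multiset (counting multiplicity) by $x-(2i-1)$ (resp. $x-2i$), for all $i$. Repeat until $M_1=M_2=\varnothing$: set $i=0$; while $M_1\cap M_2=\varnothing$ apply $\mathrm{Op}_1$ to $M_1$, $\mathrm{Op}_2$ to $M_2$ and increase $i$ by $1$; then record $(S,i)$ with $S=M_1\cap M_2$ (multiset intersection) and remove $S$ from both. The records $(S_1,i_1),\dots,(S_s,i_s)$ give $j_a=i_1+\dots+i_a$, $m_{j_a}=|S_a|$, and riggings $(J^{(j_a)}_i)_{1\le i\le m_{j_a}}$ = elements of $S_a$ in increasing order. The path $p=T_1^d(p_+)$ has soliton content $\mathbf m=(m_1,\dots,m_N)$ if $\{j_1,\dots,j_s\}=\{1,\dots,N\}$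 with these multiplicities (this is independent of the decomposition). Vacancy numbers $p_j=L-2\sum_k\min(j,k)m_k$; $B_{j,k}=2\min(j,k)$. For $m\ge1,q\ge0$: $\overline{\mathcal J}(m,q)=\{(J_i)_{i\in\mathbb Z}:J_i\in\mathbb Z, J_i\le J_{i+1}, J_{i+m}=J_i+q\}$; for a positive common divisor $\alpha$ of $m,q$ (every positive integer divides $0$), $\overline{\mathcal J}^{(\alpha)}(m,q)=\{J\in\overline{\mathcal J}(m/\alpha,q/\alpha):J\notin\overline{\mathcal J}(m/\alpha',q/\alpha')$ for all common divisors $\alpha'>\alpha\}$. Extend riggings quasi-periodically by $J^{(j)}_{i+m_j}=J^{(j)}_i+p_j$ and add $d$ to all entries. For $\boldsymbol\alpha=(\alpha_j)$, $\alpha_j$ a positive common divisor of $m_j,p_j$, $p$ has symmetry $\boldsymbol\alpha$ (written $p\in\mathcal P^{(\boldsymbol\alpha)}(\mathbf m)$) if the resulting sequence $(J^{(j)}_i+d)_{i,j}$ lies in $\prod_j\overline{\mathcal J}^{(\alpha_j)}(m_j,p_j)$ (this is independent of the decomposition $p=T_1^d(p_+)$). Finally $F^{(\boldsymbol\alpha)}_{j,k}=(\delta_{j,k}p_k+B_{j,k}m_k)/\alpha_k$. *)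

theory Defs
  imports Main "HOL-Library.Multiset"
begin

definition paths :: "nat \<Rightarrow> nat list set" where
  "paths L = {b. length b = L \<and> set b \<subseteq> {1,2} \<and>
                 count_list b 2 \<le> count_list b 1}"

text \<open>An element 1^(k-a) 2^a of B_k is represented by a (0 <= a <= k).
  R_k (a, b) = (b', a').\<close>
definition Rk :: "nat \<Rightarrow> nat \<Rightarrow> nat \<Rightarrow> nat \<times> nat" where
  "Rk k a b =
     (if b = 1 then (if a = 0 then (1, 0) else (2, a - 1))
      else (if a = k then (2, k) else (1, a + 1)))"

fun carry :: "nat \<Rightarrow> nat \<Rightarrow> nat list \<Rightarrow> nat list \<times> nat" where
  "carry k a [] = ([], a)"
| "carry k a (b # bs) =
     (let (b', a') = Rk k a b; (bs', af) = carry k a' bs in (b' # bs', af))"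

definition T :: "nat \<Rightarrow> nat list \<Rightarrow> nat list" where
  "T k p = fst (carry k (snd (carry k 0 p)) p)"

definition Tinv :: "nat \<Rightarrow> nat \<Rightarrow> nat list \<Rightarrow> nat list" where
  "Tinv L k = the_inv_into (paths L) (T k)"

definition Tpow :: "nat \<Rightarrow> nat \<Rightarrow> int \<Rightarrow> nat list \<Rightarrow> nat list" where
  "Tpow L k n = (if 0 \<le> n then T k ^^ nat n else Tinv L k ^^ nat (- n))"

definition act :: "nat \<Rightarrow> nat \<Rightarrow> (nat \<Rightarrow> int) \<Rightarrow> nat list \<Rightarrow> nat list" where
  "act L N n p = foldr (\<lambda>k q. Tpow L k (n k) q) [1..<N+1] p"

definition ZN :: "nat \<Rightarrow> (nat \<Rightarrow> int) set" where
  "ZN N = {v. \<forall>j. v j \<noteq> 0 \<longrightarrow> j \<in> {1..N}}"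

definition orbit :: "nat \<Rightarrow> nat \<Rightarrow> nat list \<Rightarrow> nat list set" where
  "orbit L N p = {act L N n p | n. n \<in> ZN N}"

definition ballot :: "nat list \<Rightarrow> bool" where
  "ballot b = (\<forall>i \<le> length b. count_list (take i b) 2 \<le> count_list (take i b) 1)"

text \<open>b_j = b!(j-1); b_(L+1) := 1.\<close>
definition letter :: "nat list \<Rightarrow> nat \<Rightarrow> nat" where
  "letter b j = (if 1 \<le> j \<and> j \<le> length b then b ! (j - 1) else 1)"

definition M1 :: "nat list \<Rightarrow> int multiset" where
  "M1 b = mset [int j. j \<leftarrow> [1..<length b + 1], letter b j = 1 \<and> letter b (j + 1) = 2]"

definition M2 :: "nat list \<Rightarrow> int multiset" where
  "M2 b = mset [int j. j \<leftarrow> [1..<length b + 1], letter b j = 2 \<and> letter b (j + 1) = 1]"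

definition Op1 :: "int multiset \<Rightarrow> int multiset" where
  "Op1 M = mset (map (\<lambda>(i, x). x - (2 * int i - 1))
                  (zip [1..<size M + 1] (sorted_list_of_multiset M)))"

definition Op2 :: "int multiset \<Rightarrow> int multiset" where
  "Op2 M = mset (map (\<lambda>(i, x). x - 2 * int i)
                  (zip [1..<size M + 1] (sorted_list_of_multiset M)))"

definition Ops :: "int multiset \<times> int multiset \<Rightarrow> int multiset \<times> int multiset" where
  "Ops P = (Op1 (fst P), Op2 (snd P))"

text \<open>kkr M1 M2 recs: starting from (M1, M2) the algorithm terminates producing the
  records recs = [(S_1,i_1), ..., (S_s,i_s)].\<close>
inductive kkr :: "int multiset \<Rightarrow> int multiset \<Rightarrow> (int multiset \<times> nat) list \<Rightarrow> bool" where
  finished: "kkr {#} {#} []"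
| step: "\<not> (A = {#} \<and> B = {#}) \<Longrightarrow>
         (\<forall>n < i. fst ((Ops ^^ n) (A, B)) \<inter># snd ((Ops ^^ n) (A, B)) = {#}) \<Longrightarrow>
         S = fst ((Ops ^^ i) (A, B)) \<inter># snd ((Ops ^^ i) (A, B)) \<Longrightarrow> S \<noteq> {#} \<Longrightarrow>
         kkr (fst ((Ops ^^ i) (A, B)) - S) (snd ((Ops ^^ i) (A, B)) - S) recs \<Longrightarrow>
         kkr A B ((S, i) # recs)"

definition jpos :: "(int multiset \<times> nat) list \<Rightarrow> nat \<Rightarrow> nat" where
  "jpos recs a = sum_list (map snd (take (Suc a) recs))"

definition rigs :: "(int multiset \<times> nat) list \<Rightarrow> nat \<Rightarrow> int list" where
  "rigs recs a = sorted_list_of_multiset (fst (recs ! a))"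

definition vac :: "nat \<Rightarrow> nat \<Rightarrow> (nat \<Rightarrow> nat) \<Rightarrow> nat \<Rightarrow> int" where
  "vac L N m j = int L - 2 * (\<Sum>k=1..N. int (min j k) * int (m k))"

definition Bmat :: "nat \<Rightarrow> nat \<Rightarrow> int" where
  "Bmat j k = 2 * int (min j k)"

definition Jbar :: "nat \<Rightarrow> int \<Rightarrow> (int \<Rightarrow> int) set" where
  "Jbar m q = {J. (\<forall>i. J i \<le> J (i + 1)) \<and> (\<forall>i. J (i + int m) = J i + q)}"

definition Jbar_alpha :: "nat \<Rightarrow> nat \<Rightarrow> int \<Rightarrow> (int \<Rightarrow> int) set" where
  "Jbar_alpha \<alpha> m q = {J. J \<in> Jbar (m div \<alpha>) (q div int \<alpha>) \<and>
     (\<forall>\<alpha>'. \<alpha>' > \<alpha> \<and> \<alpha>' dvd m \<and> int \<alpha>' dvd q \<longrightarrow> J \<notin> Jbar (m div \<alpha>') (q div int \<alpha>'))}"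

text \<open>Quasi-periodic extension J_(i+m) = J_i + q of riggings J_1..J_m (given as a list),
  shifted by d.\<close>
definition Jext :: "int list \<Rightarrow> int \<Rightarrow> int \<Rightarrow> int \<Rightarrow> int" where
  "Jext rs q d i = (let mm = int (length rs) in
     rs ! nat ((i - 1) mod mm) + ((i - 1) div mm) * q + d)"

definition Palpha :: "nat \<Rightarrow> nat \<Rightarrow> (nat \<Rightarrow> nat) \<Rightarrow> (nat \<Rightarrow> nat) \<Rightarrow> nat list set" where
  "Palpha L N m \<alpha> = {p. p \<in> paths L \<and>
     (\<forall>j\<in>{1..N}. 0 < \<alpha> j \<and> \<alpha> j dvd m j \<and> int (\<alpha> j) dvd vac L N m j) \<and>
     (\<exists>d pp recs. pp \<in> paths L \<and> ballot pp \<and> p = Tpow L 1 d pp \<and>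
        kkr (M1 pp) (M2 pp) recs \<and>
        jpos recs ` {..<length recs} = {1..N} \<and>
        (\<forall>a < length recs. m (jpos recs a) = size (fst (recs ! a))) \<and>
        (\<forall>a < length recs.
           Jext (rigs recs a) (vac L N m (jpos recs a)) d
             \<in> Jbar_alpha (\<alpha> (jpos recs a)) (m (jpos recs a)) (vac L N m (jpos recs a))))}"

definition Fmat :: "nat \<Rightarrow> nat \<Rightarrow> (nat \<Rightarrow> nat) \<Rightarrow> (nat \<Rightarrow> nat) \<Rightarrow> nat \<Rightarrow> nat \<Rightarrow> int" where
  "Fmat L N m \<alpha> j k =
     ((if j = k then vac L N m k else 0) + Bmat j k * int (m k)) div int (\<alpha> k)"

definition lattice :: "nat \<Rightarrow> nat \<Rightarrow> (nat \<Rightarrow> nat) \<Rightarrow> (nat \<Rightarrow> nat) \<Rightarrow> (nat \<Rightarrow> int) set" where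
  "lattice L N m \<alpha> = {(\<lambda>j. if j \<in> {1..N} then (\<Sum>k=1..N. Fmat L N m \<alpha> j k * x k) else 0)
                        | x. x \<in> ZN N}"

definition torus_rel :: "nat \<Rightarrow> nat \<Rightarrow> (nat \<Rightarrow> nat) \<Rightarrow> (nat \<Rightarrow> nat) \<Rightarrow> ((nat \<Rightarrow> int) \<times> (nat \<Rightarrow> int)) set" where
  "torus_rel L N m \<alpha> = {(u, v). u \<in> ZN N \<and> v \<in> ZN N \<and> (\<lambda>j. u j - v j) \<in> lattice L N m \<alpha>}"

definition torus :: "nat \<Rightarrow> nat \<Rightarrow> (nat \<Rightarrow> nat) \<Rightarrow> (nat \<Rightarrow> nat) \<Rightarrow> (nat \<Rightarrow> int) set set" where
  "torus L N m \<alpha> = ZN N // torus_rel L N m \<alpha>"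

definition tshift :: "(nat \<Rightarrow> int) \<Rightarrow> (nat \<Rightarrow> int) set \<Rightarrow> (nat \<Rightarrow> int) set" where
  "tshift v c = (\<lambda>w j. w j + v j) ` c"

definition hvec :: "nat \<Rightarrow> nat \<Rightarrow> nat \<Rightarrow> int" where
  "hvec N k = (\<lambda>j. if j \<in> {1..N} then int (min j k) else 0)"

end

(*
  A path is encoded by a function Y on the integers that counts the run ends to the left of a cell:
  the letter of a cell is 2 iff Y is odd there, and Y (x + L) = Y x + 2 M. Shortening every run by
  one letter and cancelling the runs of length zero in pairs gives a shorter periodic path together
  with the quasi-periodic sequence of the positions at which cancellation happens. These sequences,
  taken over all steps, are the extended riggings. Reading this backwards, a path is
  reconstructed from arbitrary riggings by alternately merging in a doubled rigging and lengthening
  all runs. The only freedom is the labelling of the runs at each level, which is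
  exactly J^(j)_i -> J^(j)_(i+a_j) + 2 sum_k min(j,k) a_k.

  The time evolutions are linear in this picture because elimination intertwines T_k with T_(k-1)
  composed with the unit shift: in terms of the run ends z_i and the number c_i of letters of the
  i-th run that the carrier can change, T_k reads z'_i = min (z_(i+1)) (z_i + c_i) and
  c_(i+1) = k - max 0 (c_i - (z_(i+1) - z_i)), which is invariant under z_i -> z_i - i, c -> c - 1,
  k -> k - 1 up to the unit shift of z', while cancelled pairs stay in place since the carrier only
  sees the parity of Y. Hence T_k adds min(j,k) to J^(j). As the matrix min(j,k) is
  unimodular, the orbit is Z^N modulo the translations that amount to a relabelling, and the symmetry
  type says that these are the relabellings by multiples of m_j / alpha_j, i.e. the lattice of F.
*)
theory Submission
  imports Defs
begin

section \<open>Merging and lengthening runs\<close>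

text \<open>Reconstruction and time evolution live on the whole integer line, where no cell is
  distinguished. The origin matters only for the KKR multisets, whose positions lie in
  \<open>1..L\<close>; there the ballot property enters through the height of the path, which stays
  nonnegative and thereby keeps run ends from crossing the origin.

  The obstacle at every level is vacancy number 0: the rigging is then constant and has no counting
  function. The first vacancy number is also the length of the path after one elimination, and it is
  positive whenever a further level follows, so only the deepest level is degenerate and gets its
  own argument.

  The finite map \<open>T\<close> is reached by uniqueness: every carrier that returns to its
  initial load after one turn produces the same word. Hence it suffices to exhibit some periodic
  carrier, and this is built level by level.\<close>

lemma int_cut:
  fixes P :: "int \<Rightarrow> bool"
  assumes up: "\<And>x y. P x \<Longrightarrow> x \<le> y \<Longrightarrow> P y" and a: "P a" and b: "\<not> P b"
  shows "\<exists>z. \<forall>x. P x \<longleftrightarrow> z \<le> x"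
proof -
  have ex: "P (b + int (nat (a - b)))"
    using a b up[of a b] by (cases "a \<le> b") (auto intro: up)
  define n where "n = (LEAST n. P (b + int n))"
  have n: "P (b + int n)" unfolding n_def using ex by (rule LeastI)
  have nl: "\<not> P (b + int k)" if "k < n" for k
    using that not_less_Least unfolding n_def by blast
  have "P x \<longleftrightarrow> b + int n \<le> x" for x
  proof
    assume "P x"
    show "b + int n \<le> x"
    proof (rule ccontr)
      assume c: "\<not> b + int n \<le> x"
      have "b < x" using \<open>P x\<close> b up by (meson linorder_not_less)
      then have "\<not> P (b + int (nat (x - b)))" using c by (intro nl) linarith
      then show False using \<open>P x\<close> \<open>b < x\<close> by simp
    qed
  qed (use n up in blast)
  then show ?thesis by blast
qed

lemma int_cut_down:
  fixes P :: "int \<Rightarrow> bool"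
  assumes dn: "\<And>x y. P x \<Longrightarrow> y \<le> x \<Longrightarrow> P y" and a: "P a" and b: "\<not> P b"
  shows "\<exists>z. \<forall>x. P x \<longleftrightarrow> x \<le> z"
proof -
  have "\<exists>z. \<forall>x. P (- x) \<longleftrightarrow> z \<le> x"
    by (rule int_cut[of _ "- a" "- b"]) (use assms in \<open>auto intro: dn\<close>)
  then obtain z where "\<forall>x. P (- x) \<longleftrightarrow> z \<le> x" by blast
  then have "\<forall>x. P x \<longleftrightarrow> x \<le> - z" by (metis minus_le_iff minus_minus)
  then show ?thesis by blast
qed

lemma int_step_mono:
  fixes f :: "int \<Rightarrow> int"
  assumes "\<And>i. f i \<le> f (i + 1)"
  shows "mono f"
proof (rule monoI)
  fix x y :: int assume "x \<le> y"
  then show "f x \<le> f y"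
    by (induction y rule: int_ge_induct) (use assms order_trans in blast)+
qed

lemma int_step_const:
  fixes f :: "int \<Rightarrow> 'a"
  assumes "\<And>i. f (i + 1) = f i"
  shows "f x = f y"
proof -
  have "f x = f 0" for x
    by (induction x rule: int_induct[where k=0]) (use assms in \<open>auto, metis diff_add_cancel\<close>)
  then show ?thesis by metis
qed

lemma int_le_iff_eq: "(\<And>x::int. a \<le> x \<longleftrightarrow> b \<le> x) \<Longrightarrow> a = b"
  by (meson order_antisym order_refl)

lemma int_ge_iff_eq: "(\<And>x::int. x \<le> a \<longleftrightarrow> x \<le> b) \<Longrightarrow> a = b"
  by (meson order_antisym order_refl)

text \<open>The sorted sequence in which every \<open>J b\<close> is inserted twice into the sequence counted by \<open>Y\<close>.
  Stating the merge through \<open>J\<close> and not through its counting function also covers constant \<open>J\<close>,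
  which occurs when the vacancy number is 0.\<close>
definition merge_seq :: "(int \<Rightarrow> int) \<Rightarrow> (int \<Rightarrow> int) \<Rightarrow> int \<Rightarrow> int" where
  "merge_seq Y J i = (SOME z. \<forall>x. z \<le> x \<longleftrightarrow> (\<exists>b. i \<le> Y x + 2 * b \<and> J b \<le> x))"

text \<open>Undoes one elimination step: the merged sequence \<open>z i\<close> is stretched to \<open>z i + i\<close>, which lengthens
  every run by one letter; the result is again given by its counting function.\<close>
definition inflate :: "(int \<Rightarrow> int) \<Rightarrow> (int \<Rightarrow> int) \<Rightarrow> int \<Rightarrow> int" where
  "inflate Y J x = (SOME n. \<forall>i. i \<le> n \<longleftrightarrow> merge_seq Y J i + i \<le> x)"

text \<open>\<open>J 1\<close> is inserted last, since the pairs that cancel first in the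
  elimination are the last to be restored. The zero function is the word without a letter 2.\<close>

fun assemble :: "nat \<Rightarrow> (nat \<Rightarrow> int \<Rightarrow> int) \<Rightarrow> int \<Rightarrow> int" where
  "assemble 0 J = (\<lambda>x. 0)"
| "assemble (Suc t) J = inflate (assemble t (\<lambda>j. J (Suc j))) (J 1)"

lemma merge_seq_le:
  assumes Y: "mono Y" and J: "mono J"
  shows "merge_seq Y J i \<le> x \<longleftrightarrow> (\<exists>b. i \<le> Y x + 2 * b \<and> J b \<le> x)"
proof -
  let ?P = "\<lambda>x. \<exists>b. i \<le> Y x + 2 * b \<and> J b \<le> x"
  obtain b1 where b1: "i \<le> Y 0 + 2 * b1" by (rule that[of "\<bar>i - Y 0\<bar>"]) arith
  obtain b0 where b0: "Y 0 + 2 * b0 < i" by (rule that[of "- \<bar>i - Y 0\<bar> - 1"]) arith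
  have "\<exists>z. \<forall>x. ?P x \<longleftrightarrow> z \<le> x"
  proof (rule int_cut)
    show "?P y" if "?P x" "x \<le> y" for x y
    proof -
      have "Y x \<le> Y y" using monoD[OF Y that(2)] .
      then show ?thesis using that by (metis (no_types, lifting) add_right_mono order_trans)
    qed
    show "?P (max 0 (J b1))"
      by (rule exI[of _ b1]) (use b1 monoD[OF Y, of 0 "max 0 (J b1)"] in auto)
    show "\<not> ?P (min 0 (J b0 - 1))"
    proof
      assume "?P (min 0 (J b0 - 1))"
      then obtain b where b: "i \<le> Y (min 0 (J b0 - 1)) + 2 * b" "J b \<le> min 0 (J b0 - 1)" by blast
      have "\<not> b0 \<le> b" using monoD[OF J, of b0 b] b(2) by linarith
      moreover have "Y (min 0 (J b0 - 1)) \<le> Y 0" using monoD[OF Y] by simp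
      ultimately show False using b(1) b0 by linarith
    qed
  qed
  then have "\<exists>z. \<forall>x. z \<le> x \<longleftrightarrow> ?P x" by blast
  from someI_ex[OF this] show ?thesis unfolding merge_seq_def by blast
qed

lemma merge_seq_mono: "mono Y \<Longrightarrow> mono J \<Longrightarrow> mono (merge_seq Y J)"
proof (rule monoI)
  fix i j :: int assume YJ: "mono Y" "mono J" and "i \<le> j"
  moreover from this have "\<exists>b. j \<le> Y (merge_seq Y J j) + 2 * b \<and> J b \<le> merge_seq Y J j"
    by (simp flip: merge_seq_le)
  ultimately show "merge_seq Y J i \<le> merge_seq Y J j" by (meson order_trans merge_seq_le)
qed

text \<open>Growth by at least 1 per step leaves only finitely many indices between two bounds. Thus
  \<open>inflate\<close> is well defined even if the merged sequence is constant.\<close>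

lemma counting_function_ex:
  fixes y :: "int \<Rightarrow> int"
  assumes "\<And>i. y i < y (i + 1)"
  shows "\<exists>n. \<forall>i. i \<le> n \<longleftrightarrow> y i \<le> x"
proof -
  have m: "mono (\<lambda>i. y i - i)" using assms by (intro int_step_mono) (smt (verit))
  have "\<exists>n. \<forall>i. y i \<le> x \<longleftrightarrow> i \<le> n"
  proof (rule int_cut_down)
    show "y j \<le> x" if "y i \<le> x" "j \<le> i" for i j using monoD[OF m that(2)] that by linarith
    show "y (- \<bar>x - y 0\<bar>) \<le> x" using monoD[OF m, of "- \<bar>x - y 0\<bar>" 0] by linarith
    show "\<not> y (\<bar>x - y 0\<bar> + 1) \<le> x" using monoD[OF m, of 0 "\<bar>x - y 0\<bar> + 1"] by linarith
  qed
  then show ?thesis by blast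
qed

lemma le_inflate:
  assumes "mono Y" "mono J"
  shows "i \<le> inflate Y J x \<longleftrightarrow> merge_seq Y J i + i \<le> x"
proof -
  have "\<exists>n. \<forall>i. i \<le> n \<longleftrightarrow> merge_seq Y J i + i \<le> x"
    by (rule counting_function_ex) (use monoD[OF merge_seq_mono[OF assms]] in \<open>smt (verit)\<close>)
  from someI_ex[OF this] show ?thesis unfolding inflate_def by blast
qed

text \<open>Stretching separates all ends, so at most one run ends per cell: no run is
  empty.\<close>

lemma inflate_step:
  assumes "mono Y" "mono J"
  shows "inflate Y J (x + 1) = inflate Y J x \<or> inflate Y J (x + 1) = inflate Y J x + 1"
proof -
  let ?i = "inflate Y J x"
  have z: "merge_seq Y J (?i + 1) \<le> merge_seq Y J (?i + 2)" using monoD[OF merge_seq_mono[OF assms]] by simp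
  have "?i \<le> inflate Y J (x + 1)" using le_inflate[OF assms, of ?i] by (smt (verit))
  moreover have "\<not> ?i + 2 \<le> inflate Y J (x + 1)"
    using le_inflate[OF assms, of "?i + 1" x] le_inflate[OF assms, of "?i + 2" "x + 1"] z by linarith
  ultimately show ?thesis by linarith
qed

lemma inflate_mono: "mono Y \<Longrightarrow> mono J \<Longrightarrow> mono (inflate Y J)"
proof (intro int_step_mono)
  fix i assume "mono Y" "mono J"
  from inflate_step[OF this, of i] show "inflate Y J i \<le> inflate Y J (i + 1)" by linarith
qed

text \<open>Adding \<open>2 * e'\<close> to \<open>Y\<close> raises all labels, advancing the index
  of \<open>J\<close> by \<open>a\<close> lowers them by \<open>2 * a\<close>; either way the merged
  ends are only renamed. Periodicity, rigid translation and the ambiguity of riggings are all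
  instances.\<close>

lemma merge_seq_shift:
  assumes Y: "mono Y" and J: "mono J" and Y': "mono Y'" and J': "mono J'"
    and "\<And>x. Y' x = Y (x - t) + 2 * e'" and "\<And>i. J' i = J (i + a) + t"
  shows "merge_seq Y' J' i = merge_seq Y J (i - 2 * (e' - a)) + t"
proof (rule int_le_iff_eq)
  fix x
  have "merge_seq Y' J' i \<le> x \<longleftrightarrow> (\<exists>b. i \<le> Y (x - t) + 2 * e' + 2 * b \<and> J (b + a) + t \<le> x)"
    using merge_seq_le[OF Y' J'] assms(5,6) by simp
  also have "\<dots> \<longleftrightarrow> (\<exists>b. i - 2 * (e' - a) \<le> Y (x - t) + 2 * b \<and> J b \<le> x - t)"
    (is "?l \<longleftrightarrow> ?r")
  proof
    assume ?l then obtain b where "i \<le> Y (x - t) + 2 * e' + 2 * b \<and> J (b + a) + t \<le> x" by blast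
    then show ?r by (intro exI[of _ "b + a"]) auto
  next
    assume ?r then obtain b where "i - 2 * (e' - a) \<le> Y (x - t) + 2 * b \<and> J b \<le> x - t" by blast
    then show ?l by (intro exI[of _ "b - a"]) simp
  qed
  also have "\<dots> \<longleftrightarrow> merge_seq Y J (i - 2 * (e' - a)) + t \<le> x" using merge_seq_le[OF Y J, of _ "x - t"] by (simp only: le_diff_eq)
  finally show "merge_seq Y' J' i \<le> x \<longleftrightarrow> merge_seq Y J (i - 2 * (e' - a)) + t \<le> x" .
qed

text \<open>The renaming also enters the summand \<open>i\<close> of the stretched ends, so it moves
  cells by the same amount. This coupling of labels and positions is the origin of the phase shifts
  \<open>2 * min(j,k)\<close>.\<close>

lemma inflate_shift:
  assumes Y: "mono Y" and J: "mono J" and Y': "mono Y'" and J': "mono J'"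
    and "\<And>x. Y' x = Y (x - t) + 2 * e'" and "\<And>i. J' i = J (i + a) + t"
  shows "inflate Y' J' x = inflate Y J (x - t - 2 * (e' - a)) + 2 * (e' - a)"
proof (rule int_ge_iff_eq)
  fix i
  have "i \<le> inflate Y' J' x \<longleftrightarrow> merge_seq Y J (i - 2 * (e' - a)) + t + i \<le> x"
    using le_inflate[OF Y' J'] merge_seq_shift[OF assms] by simp
  also have "\<dots> \<longleftrightarrow> i - 2 * (e' - a) \<le> inflate Y J (x - t - 2 * (e' - a))"
    using le_inflate[OF Y J] by (auto simp: algebra_simps)
  finally show "i \<le> inflate Y' J' x \<longleftrightarrow> i \<le> inflate Y J (x - t - 2 * (e' - a)) + 2 * (e' - a)" by linarith
qed

lemma assemble_mono: "(\<And>j. j \<in> {1..t} \<Longrightarrow> mono (J j)) \<Longrightarrow> mono (assemble t J)"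
proof (induction t arbitrary: J)
  case 0 then show ?case by (simp add: mono_def)
next
  case (Suc t)
  then show ?case by (auto intro!: inflate_mono)
qed

text \<open>The carrier of capacity \<open>k\<close> has state \<open>a x\<close> when it reaches cell \<open>x\<close>, whose letter is 2 iff
  \<open>Y x\<close> is odd; \<open>Y\<close> drops by one exactly at the cells whose letter the carrier changes.\<close>
definition carrier_rel :: "int \<Rightarrow> int \<Rightarrow> (int \<Rightarrow> int) \<Rightarrow> (int \<Rightarrow> int) \<Rightarrow> (int \<Rightarrow> int) \<Rightarrow> bool" where
  "carrier_rel k L a Y Y' \<longleftrightarrow> (\<forall>x. 0 \<le> a x \<and> a x \<le> k \<and> a (x + L) = a x \<and>
     (if even (Y x)
      then (if a x = 0 then Y' x = Y x \<and> a (x + 1) = 0 else Y' x = Y x - 1 \<and> a (x + 1) = a x - 1)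
      else (if a x = k then Y' x = Y x \<and> a (x + 1) = k else Y' x = Y x - 1 \<and> a (x + 1) = a x + 1)))"

lemma merge_seq_period:
  assumes Y: "mono Y" and J: "mono J" and "\<And>x. Y (x + p) = Y x + 2 * n" and "\<And>i. J (i + m) = J i + p"
  shows "merge_seq Y J (i + 2 * (n + m)) = merge_seq Y J i + p"
proof -
  have 1: "Y x = Y (x - p) + 2 * n" for x using assms(3)[of "x - p"] by simp
  have 2: "J i = J (i + - m) + p" for i using assms(4)[of "i - m"] by simp
  show ?thesis using merge_seq_shift[OF Y J Y J 1 2, of "i + 2 * (n + m)"] by simp
qed

section \<open>The carrier in terms of run ends\<close>

lemma inflate_eqI:
  assumes "mono Y" "mono J" "merge_seq Y J i + i \<le> x" "x < merge_seq Y J (i + 1) + (i + 1)"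
  shows "inflate Y J x = i"
  using le_inflate[OF assms(1,2), of i x] le_inflate[OF assms(1,2), of "i + 1" x] assms(3,4) by linarith

lemma inflate_bounds:
  assumes "mono Y" "mono J"
  shows "merge_seq Y J (inflate Y J x) + inflate Y J x \<le> x" "x < merge_seq Y J (inflate Y J x + 1) + (inflate Y J x + 1)"
  using le_inflate[OF assms, of "inflate Y J x" x] le_inflate[OF assms, of "inflate Y J x + 1" x] by linarith+

lemma inflate_period:
  assumes Y: "mono Y" and J: "mono J" and "\<And>x. Y (x + p) = Y x + 2 * n" and "\<And>i. J (i + m) = J i + p"
  shows "inflate Y J (x + (p + 2 * (n + m))) = inflate Y J x + 2 * (n + m)"
proof (rule inflate_eqI[OF Y J])
  note z = merge_seq_period[OF assms]
  have e: "inflate Y J x + 2 * (n + m) + 1 = inflate Y J x + 1 + 2 * (n + m)" by simp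
  show "merge_seq Y J (inflate Y J x + 2 * (n + m)) + (inflate Y J x + 2 * (n + m)) \<le> x + (p + 2 * (n + m))"
    using inflate_bounds(1)[OF Y J, of x] unfolding z by linarith
  show "x + (p + 2 * (n + m)) < merge_seq Y J (inflate Y J x + 2 * (n + m) + 1) + (inflate Y J x + 2 * (n + m) + 1)"
    using inflate_bounds(2)[OF Y J, of x] unfolding e z by linarith
qed

text \<open>Ends are inserted in pairs, so the label of a merged run still tells its letter.\<close>

lemma merge_seq_parity:
  assumes "mono Y" "mono J" "merge_seq Y J i \<le> x" "x < merge_seq Y J (i + 1)"
  shows "even (Y x) \<longleftrightarrow> even i" "\<exists>b. i = Y x + 2 * b \<and> J b \<le> x"
proof -
  obtain b where b: "i \<le> Y x + 2 * b" "J b \<le> x" using merge_seq_le[OF assms(1,2)] assms(3) by blast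
  moreover have "\<not> i + 1 \<le> Y x + 2 * b" using merge_seq_le[OF assms(1,2)] assms(4) b(2) by (meson linorder_not_less)
  ultimately have "i = Y x + 2 * b" by linarith
  then show "even (Y x) \<longleftrightarrow> even i" "\<exists>b. i = Y x + 2 * b \<and> J b \<le> x" using b(2) by auto
qed

text \<open>In terms of the sequence \<open>z = merge_seq Y J\<close> a run of equal letters stretches from \<open>z i\<close> to
  \<open>z (i + 1)\<close>, and \<open>c i\<close> is the number of letters of that run which the carrier is able to change.\<close>
lemma carrier_runs:
  assumes Y: "mono Y" and J: "mono J" and Y': "mono Y'"
    and car: "carrier_rel k p a Y Y'"
  defines "z \<equiv> merge_seq Y J"
  defines "c \<equiv> \<lambda>i. if even i then a (z i) else k - a (z i)"
  shows "0 \<le> c i" "c i \<le> k"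
    and "c (i + 1) = k - max 0 (c i - (z (i + 1) - z i))"
    and "merge_seq Y' J i = min (z (i + 1)) (z i + c i)"
proof -
  have a: "0 \<le> a x" "a x \<le> k" for x using car unfolding carrier_rel_def by auto
  have rstep: "(if even (Y x)
      then (if a x = 0 then Y' x = Y x \<and> a (x + 1) = 0 else Y' x = Y x - 1 \<and> a (x + 1) = a x - 1)
      else (if a x = k then Y' x = Y x \<and> a (x + 1) = k else Y' x = Y x - 1 \<and> a (x + 1) = a x + 1))" for x
    using car unfolding carrier_rel_def by blast
  show "0 \<le> c i" "c i \<le> k" using a[of "z i"] by (auto simp: c_def)
  have par: "even (Y x) = even i" if "z i \<le> x" "x < z (i + 1)" for x
    using merge_seq_parity(1)[OF Y J] that unfolding z_def by blast
  \<comment> \<open>Letters agree along a run, so the counter just runs down to 0. The end point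
    \<open>z (i + 1)\<close> is included because its value is handed to the next run.\<close>
  have run: "x \<le> z (i + 1) \<longrightarrow> (if even i then a x else k - a x) = max 0 (c i - (x - z i))" if "z i \<le> x" for x
    using that
  proof (induction x rule: int_ge_induct)
    case base
    then show ?case using a[of "z i"] by (auto simp: c_def)
  next
    case (step x)
    show ?case
    proof
      assume "x + 1 \<le> z (i + 1)"
      then have "(if even i then a x else k - a x) = max 0 (c i - (x - z i))" "even (Y x) = even i"
        using step par by auto
      then show "(if even i then a (x + 1) else k - a (x + 1)) = max 0 (c i - (x + 1 - z i))"
        using rstep[of x] a[of x] by (auto split: if_splits)
    qed
  qed
  have zm: "z i \<le> z (i + 1)" using monoD[OF merge_seq_mono[OF Y J]] unfolding z_def by simp
  show "c (i + 1) = k - max 0 (c i - (z (i + 1) - z i))"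
  proof -
    \<comment> \<open>The parity flips at the end of a run, so load and free space of the carrier
      exchange roles.\<close>
    have "c (i + 1) = (if even (i + 1) then a (z (i + 1)) else k - a (z (i + 1)))" by (simp add: c_def)
    then show ?thesis using run[of "z (i + 1)"] zm by (auto split: if_splits)
  qed
  show "merge_seq Y' J i = min (z (i + 1)) (z i + c i)"
  proof (rule int_le_iff_eq)
    fix x
    note zl = merge_seq_le[OF Y J, folded z_def] and zl' = merge_seq_le[OF Y' J]
    have Y'le: "Y x - 1 \<le> Y' x" "Y' x \<le> Y x" using rstep[of x] by (auto split: if_splits)
    consider "x < z i" | "z i \<le> x" "x < z (i + 1)" | "z (i + 1) \<le> x" by linarith
    then show "merge_seq Y' J i \<le> x \<longleftrightarrow> min (z (i + 1)) (z i + c i) \<le> x"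
    proof cases
      case 1
      then have "\<not> z i \<le> x" by simp
      then have "\<not> (\<exists>b. i \<le> Y x + 2 * b \<and> J b \<le> x)" unfolding zl .
      then have "\<not> merge_seq Y' J i \<le> x" unfolding zl' using Y'le by (meson add_right_mono order_trans)
      then show ?thesis using 1 \<open>0 \<le> c i\<close> zm by linarith
    next
      case 3
      then obtain b where "i + 1 \<le> Y x + 2 * b" "J b \<le> x" using zl by blast
      then have "merge_seq Y' J i \<le> x" unfolding zl' using Y'le by (intro exI[of _ b]) linarith
      then show ?thesis using 3 by linarith
    next
      case 2
      obtain b where b: "i = Y x + 2 * b" "J b \<le> x"
        using merge_seq_parity(2)[OF Y J] 2 unfolding z_def by blast
      have nb: "\<not> (i + 1 \<le> Y x + 2 * b \<and> J b \<le> x)" for b using 2 zl[of "i + 1" x] by fastforce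
      have fl: "Y' x = Y x \<longleftrightarrow> max 0 (c i - (x - z i)) = 0" "Y' x = Y x \<or> Y' x = Y x - 1"
        using run[of x] 2 par[of x] rstep[of x] by (auto split: if_splits)
      have "merge_seq Y' J i \<le> x \<longleftrightarrow> Y' x = Y x"
      proof
        assume "Y' x = Y x"
        then show "merge_seq Y' J i \<le> x" unfolding zl' using b by auto
      next
        assume "merge_seq Y' J i \<le> x"
        then obtain b' where "i \<le> Y' x + 2 * b'" "J b' \<le> x" unfolding zl' by blast
        then show "Y' x = Y x" using nb[of b'] fl(2) by linarith
      qed
      then show ?thesis using fl(1) 2 by linarith
    qed
  qed
qed

lemma inflate_carrier:
  assumes Y: "mono Y" and J: "mono J" and Y': "mono Y'" and "0 \<le> k"
    and car: "carrier_rel k p a Y Y'"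
    and per: "\<And>x. Y (x + p) = Y x + 2 * n" "\<And>i. J (i + m) = J i + p"
  shows "\<exists>a'. carrier_rel (k + 1) (p + 2 * (n + m)) a' (inflate Y J) (\<lambda>x. inflate Y' J (x - 1))"
proof -
  define z where "z = merge_seq Y J"
  define c where "c i = (if even i then a (z i) else k - a (z i))" for i
  note runs = carrier_runs[OF Y J Y' car, folded z_def, folded c_def]
  \<comment> \<open>In each lengthened run the larger carrier can change one letter more, hence
    \<open>c + 1\<close>; \<open>g x\<close> is what is left of this at cell
    \<open>x\<close>.\<close>
  define g where "g x = max 0 (c (inflate Y J x) + 1 - (x - (z (inflate Y J x) + inflate Y J x)))" for x
  define a' where "a' x = (if even (inflate Y J x) then g x else k + 1 - g x)" for x
  have cper: "c (i + 2 * (n + m)) = c i" for i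
    using car merge_seq_period[OF Y J per] by (simp add: c_def z_def carrier_rel_def)
  note bb = inflate_bounds[OF Y J, folded z_def]
  have gb: "0 \<le> g x" "g x \<le> k + 1" for x
    using runs(2)[of "inflate Y J x"] bb(1)[of x] \<open>0 \<le> k\<close> unfolding g_def by linarith+
  have aper: "a' (x + (p + 2 * (n + m))) = a' x" for x
    unfolding a'_def g_def inflate_period[OF Y J per] cper
    using merge_seq_period[OF Y J per] by (simp add: z_def)
  \<comment> \<open>Moved by one cell, the new ends are
    \<open>min (z (i + 1)) (z i + c i) + i + 1\<close>, that is
    \<open>min (z (i + 1) + (i + 1)) ((z i + i) + (c i + 1))\<close>: the same rule for stretched
    ends and raised counters.\<close>
  have flip: "inflate Y' J (x - 1) = (if g x = 0 then inflate Y J x else inflate Y J x - 1)" for x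
  proof -
    let ?i = "inflate Y J x"
    have e: "?i - 1 + 1 = ?i" by simp
    \<comment> \<open>The new ends interlace with the old ones, which leaves only the labels
      \<open>?i\<close> and \<open>?i - 1\<close> for the cell.\<close>
    have z': "merge_seq Y' J (?i - 1) \<le> z ?i" "merge_seq Y' J ?i = min (z (?i + 1)) (z ?i + c ?i)" "z (?i + 1) \<le> merge_seq Y' J (?i + 1)"
      using runs(4)[of "?i - 1"] runs(4)[of ?i] runs(4)[of "?i + 1"] runs(1)[of "?i + 1"]
        monoD[OF merge_seq_mono[OF Y J], of "?i + 1" "?i + 1 + 1"] unfolding e by (auto simp: z_def)
    show ?thesis
    proof (cases "g x = 0")
      case True
      then have "inflate Y' J (x - 1) = ?i"
        using z' bb[of x] by (intro inflate_eqI[OF Y' J]) (auto simp: g_def)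
      then show ?thesis using True by simp
    next
      case False
      have "inflate Y' J (x - 1) = ?i - 1"
        using z' bb[of x] False by (intro inflate_eqI[OF Y' J]) (auto simp: g_def max_def min_def split: if_splits)
      then show ?thesis using False by simp
    qed
  qed
  have gnext: "g (x + 1) = (if inflate Y J (x + 1) = inflate Y J x then max 0 (g x - 1) else k + 1 - max 0 (g x - 1))" for x
  proof (cases "inflate Y J (x + 1) = inflate Y J x")
    case True
    then show ?thesis unfolding g_def by simp
  next
    case False
    let ?i = "inflate Y J x"
    have i: "inflate Y J (x + 1) = ?i + 1" using inflate_step[OF Y J, of x] False by simp
    have "z (?i + 1) + (?i + 1) = x + 1" using bb(1)[of "x + 1"] bb(2)[of x] unfolding i by linarith
    then show ?thesis using runs(3)[of ?i] runs(1,2)[of "?i + 1"] unfolding g_def i by auto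
  qed
  have "carrier_rel (k + 1) (p + 2 * (n + m)) a' (inflate Y J) (\<lambda>x. inflate Y' J (x - 1))"
    unfolding carrier_rel_def
  proof
    fix x
    have n: "inflate Y J (x + 1) = inflate Y J x \<or> inflate Y J (x + 1) = inflate Y J x + 1" by (rule inflate_step[OF Y J])
    show "0 \<le> a' x \<and> a' x \<le> k + 1 \<and> a' (x + (p + 2 * (n + m))) = a' x \<and>
     (if even (inflate Y J x)
      then (if a' x = 0 then inflate Y' J (x - 1) = inflate Y J x \<and> a' (x + 1) = 0
            else inflate Y' J (x - 1) = inflate Y J x - 1 \<and> a' (x + 1) = a' x - 1)
      else (if a' x = k + 1 then inflate Y' J (x - 1) = inflate Y J x \<and> a' (x + 1) = k + 1
            else inflate Y' J (x - 1) = inflate Y J x - 1 \<and> a' (x + 1) = a' x + 1))"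
      unfolding aper flip using n gb[of x] gnext[of x] \<open>0 \<le> k\<close>
      by (auto simp: a'_def)
  qed
  then show ?thesis by blast
qed

section \<open>Riggings of all levels: periods and time evolution\<close>

lemma assemble_translate:
  assumes "\<And>j. j \<in> {1..t} \<Longrightarrow> mono (J j)"
  shows "assemble t (\<lambda>j i. J j i + s) x = assemble t J (x - s)"
  using assms
proof (induction t arbitrary: J x)
  case (Suc t)
  have m: "mono (J 1)" "mono (assemble t (\<lambda>j. J (Suc j)))"
    using Suc.prems by (auto intro!: assemble_mono)
  have m': "mono (\<lambda>i. J 1 i + s)" using m(1) by (simp add: mono_def)
  have IH: "assemble t (\<lambda>j i. J (Suc j) i + s) x = assemble t (\<lambda>j. J (Suc j)) (x - s)" for x
    using Suc.prems by (intro Suc.IH) auto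
  have m2: "mono (assemble t (\<lambda>j i. J (Suc j) i + s))" using m(2) unfolding IH by (simp add: mono_def)
  show ?case using inflate_shift[OF m(2) m(1) m2 m', of s 0 0 x] IH by simp
qed simp

text \<open>The vacancy numbers at integer argument \<open>L\<close>, so that \<open>L\<close> may be reduced without truncation.\<close>
definition vacancy :: "int \<Rightarrow> nat \<Rightarrow> (nat \<Rightarrow> nat) \<Rightarrow> nat \<Rightarrow> int" where
  "vacancy L t m j = L - 2 * (\<Sum>k=1..t. int (min j k) * int (m k))"

definition rigged :: "int \<Rightarrow> nat \<Rightarrow> (nat \<Rightarrow> nat) \<Rightarrow> (nat \<Rightarrow> int \<Rightarrow> int) \<Rightarrow> bool" where
  "rigged L t m J \<longleftrightarrow> (\<forall>j\<in>{1..t}. 0 < m j \<and> mono (J j) \<and> (\<forall>i. J j (i + int (m j)) = J j i + vacancy L t m j))"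

lemma sum_Suc_shift: "(\<Sum>k=1..Suc t. f k) = f 1 + (\<Sum>k=1..t. f (Suc k))"
  for f :: "nat \<Rightarrow> 'a::comm_monoid_add"
  using sum.atLeast_Suc_atMost[of 1 "Suc t" f] sum.atLeast_Suc_atMost_Suc_shift[of f 1 t] by (simp add: comp_def)

lemma vacancy_1: "vacancy L t m 1 = L - 2 * (\<Sum>k=1..t. int (m k))"
  by (auto simp: vacancy_def intro!: sum.cong)

text \<open>As \<open>min (Suc j) (Suc k) = min j k + 1\<close>, dropping the first level merely
  replaces the length by the first vacancy number. This makes induction over the levels possible
  with the length as a parameter.\<close>

lemma vacancy_Suc:
  "1 \<le> j \<Longrightarrow> vacancy L (Suc t) m (Suc j) = vacancy (vacancy L (Suc t) m 1) t (\<lambda>k. m (Suc k)) j"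
  unfolding vacancy_1 unfolding vacancy_def sum_Suc_shift
  by (simp add: algebra_simps sum.distrib sum_distrib_left)

lemma rigged_mono: "rigged L t m J \<Longrightarrow> j \<in> {1..t} \<Longrightarrow> mono (J j)"
  by (simp add: rigged_def)

lemma rigged_Suc:
  assumes "rigged L (Suc t) m J"
  shows "rigged (vacancy L (Suc t) m 1) t (\<lambda>k. m (Suc k)) (\<lambda>k. J (Suc k))"
  using assms unfolding rigged_def by (auto simp: vacancy_Suc simp del: sum.cl_ivl_Suc)

lemma assemble_period:
  assumes "rigged L t m J"
  shows "assemble t J (x + L) = assemble t J x + 2 * (\<Sum>k=1..t. int (m k))"
  using assms
proof (induction t arbitrary: L m J x)
  case (Suc t)
  let ?n = "\<Sum>k=1..t. int (m (Suc k))" and ?p = "vacancy L (Suc t) m 1"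
  have r: "rigged ?p t (\<lambda>k. m (Suc k)) (\<lambda>k. J (Suc k))" by (rule rigged_Suc[OF Suc.prems])
  have mo: "mono (assemble t (\<lambda>k. J (Suc k)))" "mono (J 1)"
    using rigged_mono[OF r] rigged_mono[OF Suc.prems] by (auto intro: assemble_mono)
  have J: "J 1 (i + int (m 1)) = J 1 i + ?p" for i using Suc.prems by (simp add: rigged_def)
  have L: "L = ?p + 2 * (?n + int (m 1))" unfolding vacancy_1 sum_Suc_shift by simp
  show ?case using inflate_period[OF mo Suc.IH[OF r] J, of x] L unfolding sum_Suc_shift by (simp add: add.commute)
qed simp

text \<open>Levels and capacity go down together, so \<open>min j k\<close> counts how often a unit
  shift is split off before rigging \<open>j\<close> is reached or the capacity is used up. In both
  base cases the carrier stays empty: on the word of 1s, and at capacity 0.\<close>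

lemma assemble_carrier:
  assumes "rigged L t m J"
  shows "\<exists>a. carrier_rel (int k) L a (assemble t J) (assemble t (\<lambda>j i. J j i + int (min j k)))"
  using assms
proof (induction t arbitrary: L m J k)
  case 0
  then show ?case by (auto simp: carrier_rel_def intro!: exI[of _ "\<lambda>_. 0"])
next
  case (Suc t)
  show ?case
  proof (cases k)
    case 0
    then show ?thesis by (auto simp: carrier_rel_def intro!: exI[of _ "\<lambda>_. 0"])
  next
    case (Suc k')
    let ?n = "\<Sum>k=1..t. int (m (Suc k))" and ?p = "vacancy L (Suc t) m 1"
    let ?Y = "assemble t (\<lambda>j. J (Suc j))" and ?Y' = "assemble t (\<lambda>j i. J (Suc j) i + int (min j k'))"
    have r: "rigged ?p t (\<lambda>k. m (Suc k)) (\<lambda>k. J (Suc k))" by (rule rigged_Suc[OF Suc.prems])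
    have mo: "mono ?Y" "mono (J 1)"
      using rigged_mono[OF r] rigged_mono[OF Suc.prems] by (auto intro: assemble_mono)
    have mo1: "mono (\<lambda>i. J (Suc j) i + int (min j k'))" if "j \<in> {1..t}" for j
      using rigged_mono[OF r that] by (simp add: mono_def)
    then have mo': "mono ?Y'" by (auto intro: assemble_mono)
    have J: "J 1 (i + int (m 1)) = J 1 i + ?p" for i using Suc.prems by (simp add: rigged_def)
    have L: "L = ?p + 2 * (?n + int (m 1))" unfolding vacancy_1 sum_Suc_shift by simp
    obtain a where "carrier_rel (int k') ?p a ?Y ?Y'" using Suc.IH[OF r] by blast
    from inflate_carrier[OF mo mo' _ this assemble_period[OF r] J] obtain a' where
      a': "carrier_rel (int k' + 1) L a' (inflate ?Y (J 1)) (\<lambda>x. inflate ?Y' (J 1) (x - 1))"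
      using L by auto
    \<comment> \<open>The surplus 1 of \<open>min (Suc j) (Suc k')\<close> over
      \<open>min j k'\<close> is common to all inner levels, hence a rigid shift by one
      cell.\<close>
    have eq: "(\<lambda>j i. J (Suc j) i + int (min (Suc j) k)) = (\<lambda>j i. J (Suc j) i + int (min j k') + 1)"
      by (simp add: \<open>k = Suc k'\<close> fun_eq_iff)
    have tr: "assemble t (\<lambda>j i. J (Suc j) i + int (min (Suc j) k)) = (\<lambda>x. ?Y' (x - 1))"
      unfolding eq by (rule ext, rule assemble_translate[OF mo1])
    have m1: "mono (\<lambda>x. ?Y' (x - 1))" "mono (\<lambda>i. J 1 i + 1)" using mo mo' by (simp_all add: mono_def)
    have "assemble (Suc t) (\<lambda>j i. J j i + int (min j k)) x = inflate ?Y' (J 1) (x - 1)" for x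
      using inflate_shift[OF mo' mo(2) m1, of 1 0 0 x] using tr by (simp add: \<open>k = Suc k'\<close>)
    then have "assemble (Suc t) (\<lambda>j i. J j i + int (min j k)) = (\<lambda>x. inflate ?Y' (J 1) (x - 1))" by blast
    then show ?thesis using a' \<open>k = Suc k'\<close> by (auto simp: add.commute)
  qed
qed

section \<open>Periodic carriers on words\<close>

text \<open>The first letter sits at cell 0, so the letter \<open>b_j\<close> is read at cell
  \<open>j - 1\<close>, and a run whose last letter is \<open>b_j\<close> shows as a step of
  \<open>Y\<close> at cell \<open>j\<close>.\<close>

definition word :: "nat \<Rightarrow> (int \<Rightarrow> int) \<Rightarrow> nat list" where
  "word L Y = map (\<lambda>i. if odd (Y (int i)) then 2 else 1) [0..<L]"

lemma Rk_carrier_rel: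
  assumes "carrier_rel (int k) L a Y Y'"
  shows "Rk k (nat (a x)) (if odd (Y x) then 2 else 1) = (if odd (Y' x) then 2 else 1, nat (a (x + 1)))"
proof -
  have "0 \<le> a x \<and> a x \<le> int k \<and> 
     (if even (Y x)
      then (if a x = 0 then Y' x = Y x \<and> a (x + 1) = 0 else Y' x = Y x - 1 \<and> a (x + 1) = a x - 1)
      else (if a x = int k then Y' x = Y x \<and> a (x + 1) = int k else Y' x = Y x - 1 \<and> a (x + 1) = a x + 1))"
    using assms unfolding carrier_rel_def by blast
  then show ?thesis
    unfolding Rk_def by (auto simp: nat_diff_distrib nat_add_distrib nat_eq_iff split: if_splits)
qed

lemma carry_carrier_rel:
  assumes "carrier_rel (int k) L a Y Y'"
  shows "carry k (nat (a x)) (map (\<lambda>i. if odd (Y (x + int i)) then 2 else 1) [0..<l]) =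
    (map (\<lambda>i. if odd (Y' (x + int i)) then 2 else 1) [0..<l], nat (a (x + int l)))"
proof (induction l arbitrary: x)
  case (Suc l)
  have e: "x + 1 + int i = x + (1 + int i)" for i by simp
  show ?case
    using Suc.IH[of "x + 1"] Rk_carrier_rel[OF assms, of x]
    unfolding map_upt_Suc by (simp add: e)
qed simp

lemma carry_word:
  assumes "carrier_rel (int k) (int L) a Y Y'"
  shows "carry k (nat (a 0)) (word L Y) = (word L Y', nat (a 0))" "nat (a 0) \<le> k"
proof -
  have "a (0 + int L) = a 0" "a 0 \<le> int k" using assms unfolding carrier_rel_def by blast+
  then show "carry k (nat (a 0)) (word L Y) = (word L Y', nat (a 0))" "nat (a 0) \<le> k"
    using carry_carrier_rel[OF assms, of 0 L] unfolding word_def by auto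
qed

section \<open>Finite carriers: conservation, reversal, comparison\<close>

lemma carry_length: "length (fst (carry k a p)) = length p"
  by (induction p arbitrary: a) (auto simp: Let_def case_prod_unfold)

lemma Rk_bounds:
  assumes "a \<le> k" "b \<in> {1, 2}" "Rk k a b = (b', a')"
  shows "a' \<le> k" "b' \<in> {1, 2}" "Rk k a' b' = (b, a)" "(b = 2 \<longrightarrow> a + 1 = a' + (if b' = 2 then 1 else 0))"
    "(b = 1 \<longrightarrow> a = a' + (if b' = 2 then 1 else 0))"
  using assms by (auto simp: Rk_def split: if_splits)

lemma carry_conserves:
  assumes "a \<le> k" "set p \<subseteq> {1, 2}" "carry k a p = (p', a')"
  shows "a' \<le> k" "set p' \<subseteq> {1, 2}" "count_list p 2 + a = count_list p' 2 + a'"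
proof -
  have "a' \<le> k \<and> set p' \<subseteq> {1, 2} \<and> count_list p 2 + a = count_list p' 2 + a'"
    using assms
  proof (induction p arbitrary: a p')
    case (Cons b p)
    obtain b' a1 where R: "Rk k a b = (b', a1)" by fastforce
    obtain p1 a2 where c: "carry k a1 p = (p1, a2)" by fastforce
    have p': "p' = b' # p1" "a' = a2" using Cons.prems(3) R c by auto
    have b: "b \<in> {1, 2}" "set p \<subseteq> {1, 2}" using Cons.prems(2) by auto
    note r = Rk_bounds[OF Cons.prems(1) b(1) R]
    show ?case using Cons.IH[OF r(1) b(2)] c r b(1) p' by auto
  qed auto
  then show "a' \<le> k" "set p' \<subseteq> {1, 2}" "count_list p 2 + a = count_list p' 2 + a'" by auto
qed

lemma carry_append:
  "carry k a (p @ q) = (fst (carry k a p) @ fst (carry k (snd (carry k a p)) q), snd (carry k (snd (carry k a p)) q))"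
  by (induction p arbitrary: a) (auto simp: Let_def case_prod_unfold)

lemma carry_rev:
  assumes "a \<le> k" "set p \<subseteq> {1, 2}" "carry k a p = (p', a')"
  shows "carry k a' (rev p') = (rev p, a)"
  using assms
proof (induction p arbitrary: a p')
  case (Cons b p)
  obtain b' a1 where R: "Rk k a b = (b', a1)" by fastforce
  obtain p1 a2 where c: "carry k a1 p = (p1, a2)" by fastforce
  have p': "p' = b' # p1" "a' = a2" using Cons.prems(3) R c by auto
  have b: "b \<in> {1, 2}" "set p \<subseteq> {1, 2}" using Cons.prems(2) by auto
  note r = Rk_bounds[OF Cons.prems(1) b(1) R]
  show ?case using Cons.IH[OF r(1) b(2)] c r p' by (simp add: carry_append)
qed auto

text \<open>The distance of two carriers shrinks only when the lower one is empty or the upper one is full;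
  an upper carrier that stays above the lower one is never empty, which gives the last claim.\<close>
lemma carry_compare:
  assumes "a \<le> b" "b \<le> k" "set p \<subseteq> {1, 2}" "carry k a p = (pa, fa)" "carry k b p = (pb, fb)"
  shows "fa \<le> fb" "fb - fa \<le> b - a" "fb - fa = b - a \<Longrightarrow> pa = pb"
    "fa < fb \<Longrightarrow> fb + count_list p 1 \<le> b + count_list p 2"
proof -
  have "fa \<le> fb \<and> fb - fa \<le> b - a \<and> (fb - fa = b - a \<longrightarrow> pa = pb) \<and>
    (fa < fb \<longrightarrow> fb + count_list p 1 \<le> b + count_list p 2)"
    using assms
  proof (induction p arbitrary: a b pa pb fa fb)
    case (Cons c p)
    obtain ca a1 where R: "Rk k a c = (ca, a1)" by fastforce
    obtain cb b1 where R': "Rk k b c = (cb, b1)" by fastforce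
    obtain p1 a2 where c: "carry k a1 p = (p1, a2)" by fastforce
    obtain p2 b2 where c': "carry k b1 p = (p2, b2)" by fastforce
    have e: "pa = ca # p1" "fa = a2" "pb = cb # p2" "fb = b2" using Cons.prems(4,5) R c R' c' by auto
    have cc: "c \<in> {1, 2}" "set p \<subseteq> {1, 2}" using Cons.prems(3) by auto
    have s: "a1 \<le> b1 \<and> b1 \<le> k \<and> b1 - a1 \<le> b - a \<and> (b1 - a1 = b - a \<longrightarrow> ca = cb) \<and>
      (a1 < b1 \<longrightarrow> b1 + (if c = 1 then 1 else 0) \<le> b + (if c = 2 then 1 else 0))"
      using R R' cc(1) Cons.prems(1,2) by (auto simp: Rk_def split: if_splits)
    have IH: "a2 \<le> b2 \<and> b2 - a2 \<le> b1 - a1 \<and> (b2 - a2 = b1 - a1 \<longrightarrow> p1 = p2) \<and>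
      (a2 < b2 \<longrightarrow> b2 + count_list p 1 \<le> b1 + count_list p 2)"
      using Cons.IH[OF _ _ cc(2) c c'] s by blast
    show ?case using s IH e cc(1) by auto
  qed auto
  then show "fa \<le> fb" "fb - fa \<le> b - a" "fb - fa = b - a \<Longrightarrow> pa = pb"
    "fa < fb \<Longrightarrow> fb + count_list p 1 \<le> b + count_list p 2" by blast+
qed

text \<open>The second turn starts with load \<open>v\<close> and cannot end lower than the first.
  If it ended higher, its gain would be at most the surplus of 2s over 1s, which is not positive in
  a path.\<close>

lemma T_fixed_carrier:
  assumes "p \<in> paths L"
  shows "\<exists>v\<le>k. carry k v p = (T k p, v)"
proof -
  have p: "set p \<subseteq> {1, 2}" "count_list p 2 \<le> count_list p 1" using assms by (auto simp: paths_def)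
  obtain q v where c0: "carry k 0 p = (q, v)" by fastforce
  obtain q' w where cv: "carry k v p = (q', w)" by fastforce
  have vk: "v \<le> k" using carry_conserves(1)[OF _ p(1) c0] by simp
  note cmp = carry_compare[OF _ vk p(1) c0 cv]
  have "w = v" using cmp(1) cmp(4) p(2) by fastforce
  then show ?thesis using c0 cv vk by (auto simp: T_def)
qed

text \<open>The distance of two carriers can only shrink; if both return to their loads it has not
  shrunk, and then their outputs agree.\<close>

lemma T_eqI:
  assumes "p \<in> paths L" "c \<le> k" "carry k c p = (q, c)"
  shows "T k p = q"
proof -
  have p: "set p \<subseteq> {1, 2}" using assms(1) by (auto simp: paths_def)
  obtain v where v: "v \<le> k" "carry k v p = (T k p, v)" using T_fixed_carrier[OF assms(1)] by blast
  show ?thesis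
  proof (cases "v \<le> c")
    case True
    then show ?thesis using carry_compare(3)[OF True assms(2) p v(2) assms(3)] by simp
  next
    case False
    then show ?thesis using carry_compare(3)[OF _ v(1) p assms(3) v(2)] by simp
  qed
qed

text \<open>A carrier that returns to its load has kept the number of 2s. The direction from output
  to input serves the negative powers.\<close>

lemma paths_carry:
  assumes "c \<le> k" "length p = L" "set p \<subseteq> {1, 2}" "carry k c p = (q, c)"
  shows "p \<in> paths L \<longleftrightarrow> q \<in> paths L"
proof -
  have len: "length q = L" using carry_length[of k c p] assms by simp
  note cc = carry_conserves[OF assms(1,3,4)]
  have sum: "count_list r 1 + count_list r 2 = length r" if "set r \<subseteq> {1, 2}" for r :: "nat list"
    using that by (induction r) auto
  show ?thesis using sum[OF assms(3)] sum[OF cc(2)] cc len assms by (auto simp: paths_def)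
qed

lemma T_paths:
  assumes "p \<in> paths L"
  shows "T k p \<in> paths L"
proof -
  obtain v where v: "v \<le> k" "carry k v p = (T k p, v)" using T_fixed_carrier[OF assms] by blast
  show ?thesis using paths_carry[OF v(1) _ _ v(2)] assms by (simp add: paths_def)
qed

lemma rev_paths: "p \<in> paths L \<Longrightarrow> rev p \<in> paths L"
  by (auto simp: paths_def)

text \<open>\<open>Rk\<close> is an involution, so conjugation by reversal inverts \<open>T k\<close>.\<close>
lemma T_rev:
  assumes "p \<in> paths L"
  shows "T k (rev (T k p)) = rev p"
proof -
  obtain v where v: "v \<le> k" "carry k v p = (T k p, v)" using T_fixed_carrier[OF assms] by blast
  have "carry k v (rev (T k p)) = (rev p, v)"
    using carry_rev[OF v(1) _ v(2)] assms by (simp add: paths_def)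
  then show ?thesis by (rule T_eqI[OF rev_paths[OF T_paths[OF assms]] v(1)])
qed

lemma T_inj: "inj_on (T k) (paths L)"
  by (rule inj_onI) (metis T_rev rev_rev_ident)

lemma Tinv_eq: "p \<in> paths L \<Longrightarrow> Tinv L k (T k p) = p"
  unfolding Tinv_def by (rule the_inv_into_f_f[OF T_inj])

lemma T_word:
  assumes "rigged (int L) t m J" "word L (assemble t J) \<in> paths L"
  shows "T k (word L (assemble t J)) = word L (assemble t (\<lambda>j i. J j i + int (min j k)))"
proof -
  obtain a where "carrier_rel (int k) (int L) a (assemble t J) (assemble t (\<lambda>j i. J j i + int (min j k)))"
    using assemble_carrier[OF assms(1)] by blast
  from carry_word[OF this] show ?thesis using T_eqI[OF assms(2)] by blast
qed

lemma word_paths_translate: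
  assumes "rigged (int L) t m J"
  shows "word L (assemble t J) \<in> paths L \<longleftrightarrow> word L (assemble t (\<lambda>j i. J j i + int (min j k))) \<in> paths L"
proof -
  obtain a where "carrier_rel (int k) (int L) a (assemble t J) (assemble t (\<lambda>j i. J j i + int (min j k)))"
    using assemble_carrier[OF assms(1)] by blast
  from carry_word[OF this] show ?thesis by (intro paths_carry) (auto simp: word_def)
qed

lemma rigged_translate: "rigged L t m J \<Longrightarrow> rigged L t m (\<lambda>j i. J j i + w j)"
  by (auto simp: rigged_def mono_def)

lemma Tpow_word:
  assumes "rigged (int L) t m J" "word L (assemble t J) \<in> paths L"
  shows "Tpow L k n (word L (assemble t J)) = word L (assemble t (\<lambda>j i. J j i + n * int (min j k)))
    \<and> word L (assemble t (\<lambda>j i. J j i + n * int (min j k))) \<in> paths L"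
proof -
  have pos: "(T k ^^ r) (word L (assemble t J)) = word L (assemble t (\<lambda>j i. J j i + int r * int (min j k)))
    \<and> word L (assemble t (\<lambda>j i. J j i + int r * int (min j k))) \<in> paths L" for r
  proof (induction r)
    case (Suc r)
    let ?J = "\<lambda>j i. J j i + int r * int (min j k)"
    have r: "rigged (int L) t m ?J" by (rule rigged_translate[OF assms(1)])
    have e: "(\<lambda>j i. ?J j i + int (min j k)) = (\<lambda>j i. J j i + int (Suc r) * int (min j k))"
      by (simp add: fun_eq_iff algebra_simps)
    show ?case using Suc T_word[OF r, of k] word_paths_translate[OF r, of k] unfolding e by simp
  qed (use assms in simp)
  have neg: "(Tinv L k ^^ r) (word L (assemble t J)) = word L (assemble t (\<lambda>j i. J j i + - int r * int (min j k)))
    \<and> word L (assemble t (\<lambda>j i. J j i + - int r * int (min j k))) \<in> paths L" for r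
  proof (induction r)
    case (Suc r)
    let ?J = "\<lambda>j i. J j i + - int (Suc r) * int (min j k)"
    have r: "rigged (int L) t m ?J" by (rule rigged_translate[OF assms(1)])
    have e: "(\<lambda>j i. ?J j i + int (min j k)) = (\<lambda>j i. J j i + - int r * int (min j k))"
      by (simp add: fun_eq_iff algebra_simps)
    \<comment> \<open>The known word is the image under \<open>T k\<close> of the one with riggings
      lowered once more, so membership in \<open>paths L\<close> is transported backwards.\<close>
    have p: "word L (assemble t ?J) \<in> paths L" using word_paths_translate[OF r, of k] Suc unfolding e by blast
    show ?case using Suc T_word[OF r p, of k] Tinv_eq[OF p, of k] p unfolding e by simp
  qed (use assms in simp)
  show ?thesis
    using pos[of "nat n"] neg[of "nat (- n)"] by (cases "0 \<le> n") (simp_all add: Tpow_def)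
qed

text \<open>The matrix \<open>min(j,k)\<close> applied to \<open>n\<close>. It gives the velocity of
  the riggings under time evolution and, doubled, the phase shift caused by a relabelling.\<close>

definition slope :: "nat \<Rightarrow> (nat \<Rightarrow> int) \<Rightarrow> nat \<Rightarrow> int" where
  "slope N n j = (\<Sum>k=1..N. n k * int (min j k))"

lemma act_word:
  assumes r: "rigged (int L) t m J" and p: "word L (assemble t J) \<in> paths L"
  shows "act L N n (word L (assemble t J)) = word L (assemble t (\<lambda>j i. J j i + slope N n j))"
    "word L (assemble t (\<lambda>j i. J j i + slope N n j)) \<in> paths L"
proof -
  have "foldr (\<lambda>k q. Tpow L k (n k) q) ks (word L (assemble t J)) =
      word L (assemble t (\<lambda>j i. J j i + (\<Sum>k\<leftarrow>ks. n k * int (min j k)))) \<and>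
      word L (assemble t (\<lambda>j i. J j i + (\<Sum>k\<leftarrow>ks. n k * int (min j k)))) \<in> paths L" for ks
  proof (induction ks)
    case (Cons k ks)
    have e: "(\<lambda>j i. J j i + (\<Sum>k\<leftarrow>ks. n k * int (min j k)) + n k * int (min j k))
        = (\<lambda>j i. J j i + (\<Sum>k\<leftarrow>k # ks. n k * int (min j k)))"
      by (simp add: fun_eq_iff)
    show ?case
      using Cons Tpow_word[OF rigged_translate[OF r], of "\<lambda>j. \<Sum>k\<leftarrow>ks. n k * int (min j k)" k "n k"]
      unfolding e by simp
  qed (use p in simp)
  note fold = this[of "[1..<N + 1]"]
  have "(\<Sum>k\<leftarrow>[1..<N + 1]. n k * int (min j k)) = slope N n j" for j
    unfolding slope_def interv_sum_list_conv_sum_set_nat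
    by (simp only: set_upt Suc_eq_plus1[symmetric] atLeastLessThanSuc_atLeastAtMost)
  then have S: "(\<lambda>j i. J j i + (\<Sum>k\<leftarrow>[1..<N + 1]. n k * int (min j k))) = (\<lambda>j i. J j i + slope N n j)"
    by presburger
  show "act L N n (word L (assemble t J)) = word L (assemble t (\<lambda>j i. J j i + slope N n j))"
    "word L (assemble t (\<lambda>j i. J j i + slope N n j)) \<in> paths L"
    using fold unfolding act_def S by blast+
qed

section \<open>Relabelling is the only ambiguity\<close>

lemma assemble_step:
  assumes "\<And>j. j \<in> {1..t} \<Longrightarrow> mono (J j)"
  shows "assemble t J (x + 1) = assemble t J x \<or> assemble t J (x + 1) = assemble t J x + 1"
proof (cases t)
  case (Suc t')
  have "mono (assemble t' (\<lambda>j. J (Suc j)))" "mono (J 1)" using assms Suc by (auto intro!: assemble_mono)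
  from inflate_step[OF this, of x] show ?thesis unfolding Suc by simp
qed simp

text \<open>For steps 0 or 1 the parity decides whether a step occurs, so both functions have the
  same increments.\<close>

lemma same_parity_offset:
  fixes f g :: "int \<Rightarrow> int"
  assumes "\<And>x. f (x + 1) = f x \<or> f (x + 1) = f x + 1" "\<And>x. g (x + 1) = g x \<or> g (x + 1) = g x + 1"
    and "\<And>x. even (f x) = even (g x)"
  shows "\<exists>e. \<forall>x. f x = g x + 2 * e"
proof -
  have "f (x + 1) - g (x + 1) = f x - g x" for x
    using assms(1,2)[of x] assms(3)[of x] assms(3)[of "x + 1"] by auto
  then have c: "f x - g x = f 0 - g 0" for x by (rule int_step_const)
  have "even (f 0 - g 0)" using assms(3)[of 0] by simp
  then obtain e where e: "f 0 - g 0 = 2 * e" by (rule evenE)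
  have "\<forall>x. f x = g x + 2 * e" 
  proof
    fix x show "f x = g x + 2 * e" using c[of x] e by linarith
  qed
  then show ?thesis by blast
qed

lemma quasi_periodic_multiple:
  fixes J :: "int \<Rightarrow> int"
  assumes "\<And>i. J (i + m) = J i + p"
  shows "J (i + r * m) = J i + r * p"
proof (induction r rule: int_induct[where k=0])
  case (step1 r)
  then show ?case using assms[of "i + r * m"] by (simp add: algebra_simps)
next
  case (step2 r)
  then show ?case using assms[of "i + (r - 1) * m"] by (simp add: algebra_simps)
qed simp

lemma counting_function_qp:
  fixes J :: "int \<Rightarrow> int"
  assumes "mono J" "0 < p" "0 < m" "\<And>i. J (i + m) = J i + p"
  shows "\<exists>n. \<forall>b. b \<le> n \<longleftrightarrow> J b \<le> x"
proof -
  have ge: "\<bar>x - J 0\<bar> \<le> \<bar>x - J 0\<bar> * p" using assms(2) by (simp add: mult_le_cancel_left1)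
  have "\<exists>n. \<forall>b. J b \<le> x \<longleftrightarrow> b \<le> n"
  proof (rule int_cut_down)
    show "J c \<le> x" if "J b \<le> x" "c \<le> b" for b c using monoD[OF assms(1) that(2)] that(1) by linarith
    show "J (0 + - \<bar>x - J 0\<bar> * m) \<le> x"
      unfolding quasi_periodic_multiple[of J m p, OF assms(4)] using ge by linarith
    show "\<not> J (0 + (\<bar>x - J 0\<bar> + 1) * m) \<le> x"
      unfolding quasi_periodic_multiple[of J m p, OF assms(4)] using ge assms(2) by (simp add: algebra_simps)
  qed
  then show ?thesis by blast
qed

lemma quasi_periodic_0_const:
  fixes J :: "int \<Rightarrow> int"
  assumes "mono J" "0 < m" "\<And>i. J (i + m) = J i"
  shows "J i = J j"
proof (rule int_step_const[of J])
  fix i show "J (i + 1) = J i"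
    using monoD[OF assms(1), of i "i + 1"] monoD[OF assms(1), of "i + 1" "i + m"] assms by auto
qed

lemma mono_period_nonneg:
  fixes J :: "int \<Rightarrow> int"
  assumes "mono J" "0 < m" "\<And>i. J (i + m) = J i + p"
  shows "0 \<le> p"
  using monoD[OF assms(1), of 0 m] assms(2) assms(3)[of 0] by simp

text \<open>The merged count \<open>Y x + 2 * K x\<close> has the parity of \<open>Y x\<close>, and
  parity recovers \<open>Y\<close> up to an even constant. What remains is the counting function of
  \<open>J\<close>, which exists because the period is positive.\<close>

lemma merge_unique:
  assumes Y: "mono Y" and J: "mono J" and Y': "mono Y'" and J': "mono J'"
    and st: "\<And>x. Y (x + 1) = Y x \<or> Y (x + 1) = Y x + 1" "\<And>x. Y' (x + 1) = Y' x \<or> Y' (x + 1) = Y' x + 1"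
    and p: "0 < p" "0 < m" and per: "\<And>i. J (i + m) = J i + p" "\<And>i. J' (i + m) = J' i + p"
    and merge_seq: "\<And>i. merge_seq Y' J' i = merge_seq Y J (i - 2 * e) + t"
  shows "\<exists>a e'. e = e' - a \<and> (\<forall>x. Y' x = Y (x - t) + 2 * e') \<and> (\<forall>i. J' i = J (i + a) + t)"
proof -
  from counting_function_qp[OF J p per(1)] obtain K where K: "\<And>x b. b \<le> K x \<longleftrightarrow> J b \<le> x" by metis
  from counting_function_qp[OF J' p per(2)] obtain K' where K': "\<And>x b. b \<le> K' x \<longleftrightarrow> J' b \<le> x" by metis
  have zK: "merge_seq Y J i \<le> x \<longleftrightarrow> i \<le> Y x + 2 * K x" for i x
    unfolding merge_seq_le[OF Y J] K[symmetric] by (meson add_left_mono mult_left_mono order_refl order_trans zero_le_numeral)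
  have zK': "merge_seq Y' J' i \<le> x \<longleftrightarrow> i \<le> Y' x + 2 * K' x" for i x
    unfolding merge_seq_le[OF Y' J'] K'[symmetric] by (meson add_left_mono mult_left_mono order_refl order_trans zero_le_numeral)
  have eq: "Y' x + 2 * K' x = Y (x - t) + 2 * K (x - t) + 2 * e" for x
  proof (rule int_ge_iff_eq)
    fix i
    have "i \<le> Y' x + 2 * K' x \<longleftrightarrow> merge_seq Y J (i - 2 * e) \<le> x - t" unfolding zK'[symmetric] merge_seq by linarith
    then show "i \<le> Y' x + 2 * K' x \<longleftrightarrow> i \<le> Y (x - t) + 2 * K (x - t) + 2 * e" unfolding zK by linarith
  qed
  have "\<exists>e'. \<forall>x. Y' x = Y (x - t) + 2 * e'"
  proof (rule same_parity_offset)
    show "Y' (x + 1) = Y' x \<or> Y' (x + 1) = Y' x + 1" for x by (rule st)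
    show "Y (x + 1 - t) = Y (x - t) \<or> Y (x + 1 - t) = Y (x - t) + 1" for x
      using st(1)[of "x - t"] by (simp add: algebra_simps)
    show "even (Y' x) = even (Y (x - t))" for x using eq[of x] by presburger
  qed
  then obtain e' where e': "\<And>x. Y' x = Y (x - t) + 2 * e'" by blast
  have K'K: "K' x = K (x - t) + (e - e')" for x using eq[of x] e'[of x] by linarith
  have "J' i = J (i + (e' - e)) + t" for i
  proof (rule int_le_iff_eq)
    fix x
    have "J' i \<le> x \<longleftrightarrow> i + (e' - e) \<le> K (x - t)" unfolding K'[symmetric] K'K by linarith
    then show "J' i \<le> x \<longleftrightarrow> J (i + (e' - e)) + t \<le> x" unfolding K by linarith
  qed
  then show ?thesis using e' by (intro exI[of _ "e' - e"] exI[of _ e']) auto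
qed

text \<open>Arbitrarily many pairs sit at the single position \<open>J 0\<close>, so every label
  lands there.\<close>

lemma merge_seq_const:
  assumes "\<And>b. J b = J 0"
  shows "merge_seq (\<lambda>x. 0) J i = J 0"
proof (rule int_le_iff_eq)
  fix x
  have m: "mono (\<lambda>x::int. 0::int)" "mono J" using assms by (auto simp: mono_def) (metis order_refl)
  have "i \<le> 0 + 2 * \<bar>i\<bar>" by arith
  then show "merge_seq (\<lambda>x. 0) J i \<le> x \<longleftrightarrow> J 0 \<le> x" unfolding merge_seq_le[OF m] using assms by metis
qed

lemma inflate_shiftD:
  assumes Y: "mono Y" and J: "mono J" and Y': "mono Y'" and J': "mono J'"
    and b: "\<And>x. inflate Y' J' x = inflate Y J (x - s) + 2 * e"
  shows "merge_seq Y' J' i = merge_seq Y J (i - 2 * e) + (s - 2 * e)"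
proof (rule int_le_iff_eq)
  fix x
  have "merge_seq Y' J' i \<le> x \<longleftrightarrow> i \<le> inflate Y' J' (x + i)" using le_inflate[OF Y' J', of i "x + i"] by linarith
  also have "\<dots> \<longleftrightarrow> i - 2 * e \<le> inflate Y J (x + i - s)" using b[of "x + i"] by linarith
  also have "\<dots> \<longleftrightarrow> merge_seq Y J (i - 2 * e) + (s - 2 * e) \<le> x" unfolding le_inflate[OF Y J] by linarith
  finally show "merge_seq Y' J' i \<le> x \<longleftrightarrow> merge_seq Y J (i - 2 * e) + (s - 2 * e) \<le> x" .
qed

text \<open>Monotonicity of \<open>J 2\<close> makes the second vacancy number nonnegative, and the
  first exceeds it by twice the number of solitons of length at least 2.\<close>

lemma rigged_last_period:
  assumes "rigged L (Suc t) m J" "0 < t"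
  shows "0 < vacancy L (Suc t) m 1"
proof -
  have m: "0 < m 2" "mono (J 2)" "J 2 (i + int (m 2)) = J 2 i + vacancy L (Suc t) m 2" for i
    using assms by (auto simp: rigged_def)
  have "0 \<le> vacancy L (Suc t) m 2" 
    using mono_period_nonneg[of "J 2" "int (m 2)" "vacancy L (Suc t) m 2"] m by simp
  also have "vacancy L (Suc t) m 2 = vacancy L (Suc t) m 1 - 2 * (\<Sum>k=1..t. int (m (Suc k)))"
    using vacancy_Suc[of 1 L t m] unfolding vacancy_1 by (simp add: numeral_2_eq_2)
  finally have "2 * (\<Sum>k=1..t. int (m (Suc k))) \<le> vacancy L (Suc t) m 1" by simp
  moreover have "0 < (\<Sum>k=1..t. int (m (Suc k)))"
    using assms by (intro sum_pos) (auto simp: rigged_def)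
  ultimately show ?thesis by linarith
qed

lemma slope_Suc: "1 \<le> j \<Longrightarrow> slope (Suc t) a (Suc j) = (\<Sum>k=1..Suc t. a k) + slope t (\<lambda>k. a (Suc k)) j"
  unfolding slope_def sum_Suc_shift by (simp add: algebra_simps sum.distrib)

lemma slope_1: "slope t a 1 = (\<Sum>k=1..t. a k)"
  by (auto simp: slope_def intro!: sum.cong)

text \<open>The shift \<open>s\<close> is generalized because each level passes twice its total
  relabelling on to the positions of all inner levels.\<close>

lemma assemble_offset_if:
  assumes "\<And>j. j \<in> {1..t} \<Longrightarrow> mono (J j)"
    and "\<And>j i. j \<in> {1..t} \<Longrightarrow> J' j i = J j (i + a j) + s + 2 * slope t a j"
  shows "assemble t J' x = assemble t J (x - s) - 2 * (\<Sum>k=1..t. a k)"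
  using assms
proof (induction t arbitrary: J J' a s x)
  case (Suc t)
  let ?A = "\<Sum>k=1..Suc t. a k" and ?e = "- (\<Sum>k=1..t. a (Suc k))"
  have J'm: "mono (J' j)" if "j \<in> {1..Suc t}" for j
    using Suc.prems(1)[OF that] unfolding Suc.prems(2)[OF that] mono_def by simp
  have mo: "mono (J 1)" "mono (assemble t (\<lambda>j. J (Suc j)))" "mono (J' 1)" "mono (assemble t (\<lambda>j. J' (Suc j)))"
    using Suc.prems(1) J'm by (auto intro!: assemble_mono)
  have IH: "assemble t (\<lambda>j. J' (Suc j)) x = assemble t (\<lambda>j. J (Suc j)) (x - (s + 2 * ?A)) + 2 * ?e" for x
    using Suc.IH[of "\<lambda>j. J (Suc j)" "\<lambda>j. J' (Suc j)" "\<lambda>j. a (Suc j)" "s + 2 * ?A" x] Suc.prems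
    by (auto simp: slope_Suc algebra_simps simp del: sum.cl_ivl_Suc)
  have J1: "J' 1 i = J 1 (i + a 1) + (s + 2 * ?A)" for i
    using Suc.prems(2)[of 1 i] by (simp add: slope_1 del: sum.cl_ivl_Suc flip: One_nat_def)
  have A: "?e - a 1 = - ?A" unfolding sum_Suc_shift by simp
  \<comment> \<open>The summand \<open>i\<close> of the stretched ends takes back the extra shift
    \<open>2 * ?A\<close>, so that outside only \<open>s\<close> remains.\<close>
  show ?case using inflate_shift[OF mo(2) mo(1) mo(4) mo(3) IH J1, of x] unfolding A by (simp del: sum.cl_ivl_Suc)
qed simp

text \<open>Undoing the stretching turns the offset into a shift of the merged sequence by
  \<open>s - 2 * e\<close>; uniqueness of merging then separates the first rigging from the inner
  word, to which the induction applies.\<close>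

lemma assemble_offset_onlyif:
  assumes "rigged L t m J" "rigged L t m J'" "\<And>x. assemble t J' x = assemble t J (x - s) + 2 * e"
  shows "\<exists>a. (\<Sum>k=1..t. a k) = - e \<and> (\<forall>j\<in>{1..t}. \<forall>i. J' j i = J j (i + a j) + s + 2 * slope t a j)"
  using assms
proof (induction t arbitrary: J J' s e L m)
  case (Suc t)
  let ?p = "vacancy L (Suc t) m 1" and ?Y = "assemble t (\<lambda>j. J (Suc j))" and ?Y' = "assemble t (\<lambda>j. J' (Suc j))"
  let ?t = "s - 2 * e"
  note r = rigged_Suc[OF Suc.prems(1)] and r' = rigged_Suc[OF Suc.prems(2)]
  have mo: "mono (J 1)" "mono ?Y" "mono (J' 1)" "mono ?Y'"
    using rigged_mono[OF r] rigged_mono[OF r'] rigged_mono[OF Suc.prems(1)] rigged_mono[OF Suc.prems(2)]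
    by (auto intro!: assemble_mono)
  have st: "?Y (x + 1) = ?Y x \<or> ?Y (x + 1) = ?Y x + 1" "?Y' (x + 1) = ?Y' x \<or> ?Y' (x + 1) = ?Y' x + 1" for x
    by (rule assemble_step, rule rigged_mono[OF r], assumption, rule assemble_step, rule rigged_mono[OF r'])
  have m: "0 < int (m 1)" using Suc.prems(1) by (simp add: rigged_def)
  have per: "J 1 (i + int (m 1)) = J 1 i + ?p" "J' 1 (i + int (m 1)) = J' 1 i + ?p" for i
    using Suc.prems(1,2) by (simp_all add: rigged_def)
  have z: "merge_seq ?Y' (J' 1) i = merge_seq ?Y (J 1) (i - 2 * e) + ?t" for i
    by (rule inflate_shiftD[OF mo(2,1,4,3)]) (use Suc.prems(3) in simp)
  have "\<exists>a1 e'. e = e' - a1 \<and> (\<forall>x. ?Y' x = ?Y (x - ?t) + 2 * e') \<and> (\<forall>i. J' 1 i = J 1 (i + a1) + ?t)"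
  proof (cases "0 < ?p")
    case True
    show ?thesis by (rule merge_unique[OF mo(2,1,4,3) st True m per z])
  next
    case False
    then have t0: "t = 0" using rigged_last_period[OF Suc.prems(1)] by blast
    have p0: "?p = 0" using False mono_period_nonneg[OF mo(1) m per(1)] by linarith
    have c: "J 1 i = J 1 j" "J' 1 i = J' 1 j" for i j
      using quasi_periodic_0_const[OF mo(1) m] quasi_periodic_0_const[OF mo(3) m] per p0 by simp_all
    have zc: "merge_seq ?Y (J 1) i = J 1 0" "merge_seq ?Y' (J' 1) i = J' 1 0" for i
      using merge_seq_const[of "J 1" i] merge_seq_const[of "J' 1" i] c by (simp_all add: t0)
    \<comment> \<open>A constant rigging admits every relabelling, so \<open>- e\<close> is chosen
      to meet the prescribed total.\<close>
    have "J' 1 i = J 1 (i + - e) + ?t" for i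
      using z[of 0] c(2)[of i 0] c(1)[of "i + - e" 0] unfolding zc by linarith
    then show ?thesis using t0 by (intro exI[of _ "- e"] exI[of _ 0]) auto
  qed
  then obtain a1 e' where e: "e = e' - a1" and Y: "\<And>x. ?Y' x = ?Y (x - ?t) + 2 * e'"
    and J1: "\<And>i. J' 1 i = J 1 (i + a1) + ?t" by blast
  obtain a where a: "(\<Sum>k=1..t. a k) = - e'"
    "\<And>j i. j\<in>{1..t} \<Longrightarrow> J' (Suc j) i = J (Suc j) (i + a j) + ?t + 2 * slope t a j"
    using Suc.IH[OF r r' Y] by blast
  define b where "b k = (if k = 1 then a1 else a (k - 1))" for k
  have bs: "b 1 = a1" "(\<lambda>k. b (Suc k)) = (\<lambda>k. if k = 0 then a1 else a k)" by (auto simp: b_def fun_eq_iff)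
  have sl: "slope t (\<lambda>k. b (Suc k)) j = slope t a j" for j
    unfolding bs slope_def by (intro sum.cong) auto
  have B: "(\<Sum>k=1..Suc t. b k) = - e"
  proof -
    have "(\<Sum>k=1..t. b (Suc k)) = (\<Sum>k=1..t. a k)" by (intro sum.cong) (auto simp: b_def)
    then show ?thesis unfolding sum_Suc_shift using a(1) e bs(1) by simp
  qed
  have "J' j i = J j (i + b j) + s + 2 * slope (Suc t) b j" if "j \<in> {1..Suc t}" for j i
  proof (cases "j = 1")
    case True
    show ?thesis unfolding True slope_1 B J1 bs(1) by simp
  next
    case False
    then have "j = Suc (j - 1)" "j - 1 \<in> {1..t}" using that by auto
    then obtain j' where j': "j = Suc j'" "j' \<in> {1..t}" by blast
    then have "1 \<le> j'" by simp
    show ?thesis using a(2)[OF j'(2), of i] unfolding j'(1) slope_Suc[OF \<open>1 \<le> j'\<close>] B sl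
      using \<open>1 \<le> j'\<close> by (simp add: b_def)
  qed
  then show ?case using B by blast
qed simp

lemma word_eq_iff_parity:
  assumes "\<And>x. Y (x + int L) = Y x + 2 * n" "\<And>x. Y' (x + int L) = Y' x + 2 * n" "0 < L"
  shows "word L Y = word L Y' \<longleftrightarrow> (\<forall>x. even (Y x) = even (Y' x))"
proof
  assume w: "word L Y = word L Y'"
  have l: "even (Y (int i)) = even (Y' (int i))" if "i < L" for i
    using arg_cong[OF w, of "\<lambda>w. w ! i"] that by (simp add: word_def split: if_splits)
  show "\<forall>x. even (Y x) = even (Y' x)"
  proof
    fix x
    let ?y = "x mod int L"
    have x: "x = ?y + (x div int L) * int L" by simp
    have "Y x = Y ?y + (x div int L) * (2 * n)" "Y' x = Y' ?y + (x div int L) * (2 * n)"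
      using quasi_periodic_multiple[of Y "int L" "2 * n" ?y "x div int L"]
        quasi_periodic_multiple[of Y' "int L" "2 * n" ?y "x div int L"] assms(1,2) by simp_all
    moreover have "even (Y ?y) = even (Y' ?y)" using l[of "nat ?y"] assms(3) by (simp add: nat_less_iff)
    ultimately show "even (Y x) = even (Y' x)" by simp
  qed
qed (simp add: word_def)

text \<open>A word fixes \<open>Y\<close> only up to an even constant \<open>2 * e\<close>. As
  \<open>e\<close> is arbitrary, the total of the relabelling \<open>a\<close> is
  unconstrained.\<close>

lemma word_assemble_eq_iff:
  assumes "rigged (int L) t m J" "rigged (int L) t m J'" "0 < L"
  shows "word L (assemble t J') = word L (assemble t J) \<longleftrightarrow>
    (\<exists>a. \<forall>j\<in>{1..t}. \<forall>i. J' j i = J j (i + a j) + 2 * slope t a j)"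
proof
  assume "word L (assemble t J') = word L (assemble t J)"
  then have "\<forall>x. even (assemble t J' x) = even (assemble t J x)"
    using word_eq_iff_parity[of "assemble t J'" L "\<Sum>k=1..t. int (m k)" "assemble t J"]
      assemble_period[OF assms(1)] assemble_period[OF assms(2)] assms(3) by blast
  then obtain e where e: "\<forall>x. assemble t J' x = assemble t J x + 2 * e"
    using same_parity_offset[of "assemble t J'" "assemble t J"] assemble_step[where t=t and J=J, OF rigged_mono[OF assms(1)]]
      assemble_step[where t=t and J=J', OF rigged_mono[OF assms(2)]] by blast
  then show "\<exists>a. \<forall>j\<in>{1..t}. \<forall>i. J' j i = J j (i + a j) + 2 * slope t a j"
    using assemble_offset_onlyif[OF assms(1,2), of 0 e] by auto
next
  assume "\<exists>a. \<forall>j\<in>{1..t}. \<forall>i. J' j i = J j (i + a j) + 2 * slope t a j"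
  then obtain a where "\<And>j i. j \<in> {1..t} \<Longrightarrow> J' j i = J j (i + a j) + 2 * slope t a j" by blast
  then have "assemble t J' x = assemble t J x - 2 * (\<Sum>k=1..t. a k)" for x
    using assemble_offset_if[where J=J and J'=J' and a=a and s=0 and t=t and x=x, OF rigged_mono[OF assms(1)]] by simp
  then show "word L (assemble t J') = word L (assemble t J)" by (simp add: word_def)
qed

section \<open>Orbits and the torus\<close>

lemma quasi_period_combine:
  fixes J :: "int \<Rightarrow> int"
  assumes "\<And>i. J (i + a) = J i + c" "\<And>i. J (i + b) = J i + d"
  shows "J (i + (u * a + v * b)) = J i + (u * c + v * d)"
  using quasi_periodic_multiple[of J b d "i + u * a" v, OF assms(2)]
    quasi_periodic_multiple[of J a c i u, OF assms(1)] by (simp add: add.assoc)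

text \<open>Quasi-periods form a group. By Bezout, \<open>a\<close> and
  \<open>m div \<alpha>\<close> yield a quasi-period equal to their gcd; were it smaller than
  \<open>m div \<alpha>\<close>, it would come from a larger common divisor of \<open>m\<close> and
  \<open>p\<close>, against the maximality of \<open>\<alpha>\<close>.\<close>

lemma Jbar_alpha_quasi_period_iff:
  assumes J: "J \<in> Jbar_alpha \<alpha> m p" and m: "0 < m" and \<alpha>: "0 < \<alpha>" "\<alpha> dvd m" "int \<alpha> dvd p"
  shows "(\<forall>i. J (i + a) = J i + c) \<longleftrightarrow> (\<exists>x. a = x * int (m div \<alpha>) \<and> c = x * (p div int \<alpha>))"
proof
  define \<mu> where "\<mu> = int (m div \<alpha>)"
  define \<pi> where "\<pi> = p div int \<alpha>"
  have mu: "\<mu> * int \<alpha> = int m" "\<pi> * int \<alpha> = p" "0 < \<mu>"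
    using \<alpha> m by (auto simp: \<mu>_def \<pi>_def simp flip: of_nat_mult intro!: Nat.gr0I)
  have Jm: "J i \<le> J (i + 1)" "J (i + \<mu>) = J i + \<pi>" for i
    using J by (auto simp: Jbar_alpha_def Jbar_def \<mu>_def \<pi>_def)
  {
    assume a: "\<forall>i. J (i + a) = J i + c"
    define d where "d = gcd a \<mu>"
    have d: "0 < d" "d dvd a" "d dvd \<mu>" using mu(3) by (auto simp: d_def)
    obtain u v where uv: "u * a + v * \<mu> = d" using bezout_int[of a \<mu>] unfolding d_def by blast
    define e where "e = u * c + v * \<pi>"
    have Jd: "J (i + d) = J i + e" for i
      using quasi_period_combine[of J a c \<mu> \<pi> i u v] a Jm(2) unfolding uv e_def by blast
    obtain r where r: "\<mu> = r * d" using d(3) by (metis dvd_def mult.commute)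
    have r0: "0 < r" using r mu(3) d(1) by (simp add: zero_less_mult_iff)
    \<comment> \<open>Both sides move the index by \<open>int m\<close>; comparing the values shows
      that \<open>r * int \<alpha>\<close> divides \<open>p\<close> as well as
      \<open>m\<close>.\<close>
    have "J (0 + (r * int \<alpha>) * d) = J 0 + (r * int \<alpha>) * e" "J (0 + int \<alpha> * \<mu>) = J 0 + int \<alpha> * \<pi>"
      using quasi_periodic_multiple[of J d e 0 "r * int \<alpha>"] quasi_periodic_multiple[of J \<mu> \<pi> 0 "int \<alpha>"] Jd Jm(2)
      by blast+
    then have "(r * int \<alpha>) * e = int \<alpha> * \<pi>" unfolding r by (simp add: ac_simps)
    then have pe: "p = (r * int \<alpha>) * e" using mu(2) by (simp add: mult.commute)
    have me: "int m = (r * int \<alpha>) * d" unfolding mu(1)[symmetric] r by (simp add: ac_simps)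
    define \<alpha>' where "\<alpha>' = nat r * \<alpha>"
    have \<alpha>': "int \<alpha>' = r * int \<alpha>" using r0 by (simp add: \<alpha>'_def)
    have pos: "0 < int \<alpha>'" using \<alpha>(1) r0 unfolding \<alpha>' by simp
    have dv: "\<alpha>' dvd m" "int \<alpha>' dvd p" using me pe unfolding \<alpha>'[symmetric] by (simp_all flip: int_dvd_int_iff)
    have q: "int (m div \<alpha>') = d" "p div int \<alpha>' = e"
      using me pe pos unfolding \<alpha>'[symmetric] by (simp_all add: zdiv_int)
    have "J \<in> Jbar (m div \<alpha>') (p div int \<alpha>')" using Jd Jm(1) q by (simp add: Jbar_def)
    then have "\<not> \<alpha> < \<alpha>'" using J dv by (auto simp: Jbar_alpha_def)
    then have "r * int \<alpha> \<le> 1 * int \<alpha>" using \<alpha>' by linarith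
    then have "r = 1" using r0 \<alpha>(1) mult_right_le_imp_le[of r "int \<alpha>" 1] by simp
    then have "\<mu> dvd a" using r d(2) by simp
    then obtain x where x: "a = x * \<mu>" by (metis dvd_def mult.commute)
    have "J (0 + x * \<mu>) = J 0 + x * \<pi>" using quasi_periodic_multiple[of J \<mu> \<pi> 0 x] Jm(2) by blast
    then have "c = x * \<pi>" using a[rule_format, of 0] x by simp
    then show "\<exists>x. a = x * int (m div \<alpha>) \<and> c = x * (p div int \<alpha>)" using x unfolding \<mu>_def \<pi>_def by blast
  next
    assume "\<exists>x. a = x * int (m div \<alpha>) \<and> c = x * (p div int \<alpha>)"
    then show "\<forall>i. J (i + a) = J i + c"
      using quasi_periodic_multiple[of J \<mu> \<pi>] Jm(2) unfolding \<mu>_def \<pi>_def by blast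
  }
qed

lemma vacancy_vac: "vacancy (int L) N m j = vac L N m j"
  by (simp add: vacancy_def vac_def)

lemma Jbar_alpha_Jbar:
  assumes "J \<in> Jbar_alpha \<alpha> m p" "\<alpha> dvd m" "int \<alpha> dvd p"
  shows "J \<in> Jbar m p"
proof -
  have "J (i + int (m div \<alpha>)) = J i + p div int \<alpha>" "J i \<le> J (i + 1)" for i
    using assms(1) by (auto simp: Jbar_alpha_def Jbar_def)
  moreover have "int \<alpha> * int (m div \<alpha>) = int m" "int \<alpha> * (p div int \<alpha>) = p"
    using assms(2,3) by (simp_all flip: of_nat_mult)
  ultimately show ?thesis
    using quasi_periodic_multiple[of J "int (m div \<alpha>)" "p div int \<alpha>" _ "int \<alpha>"] by (simp add: Jbar_def)
qed

lemma Jbar_mono: "J \<in> Jbar m p \<Longrightarrow> mono J"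
  by (intro int_step_mono) (simp add: Jbar_def)

lemma assemble_cong: "(\<And>j. j \<in> {1..t} \<Longrightarrow> J j = J' j) \<Longrightarrow> assemble t J = assemble t J'"
proof (induction t arbitrary: J J')
  case (Suc t)
  have "assemble t (\<lambda>j. J (Suc j)) = assemble t (\<lambda>j. J' (Suc j))" by (rule Suc.IH) (use Suc.prems in simp)
  moreover have "J 1 = J' 1" using Suc.prems by simp
  ultimately show ?case by simp
qed simp

lemma slope_cong: "(\<And>k. k \<in> {1..N} \<Longrightarrow> a k = b k) \<Longrightarrow> slope N a j = slope N b j"
  by (simp add: slope_def)

text \<open>The matrix \<open>min(j,k)\<close> is unimodular.\<close>
lemma slope_surj: "\<exists>n. \<forall>j\<in>{1..N}. slope N n j = w j"
proof (induction N arbitrary: w)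
  case (Suc N)
  obtain n where n: "\<And>j. j\<in>{1..N} \<Longrightarrow> slope N n j = w (Suc j) - w 1"
    using Suc[of "\<lambda>j. w (Suc j) - w 1"] by blast
  define n' where "n' k = (if k = 1 then w 1 - (\<Sum>k=1..N. n k) else n (k - 1))" for k
  have s: "(\<Sum>k=1..Suc N. n' k) = w 1"
  proof -
    have "(\<Sum>k=1..N. n' (Suc k)) = (\<Sum>k=1..N. n k)" by (intro sum.cong) (auto simp: n'_def)
    then show ?thesis unfolding sum_Suc_shift by (simp add: n'_def)
  qed
  have "slope (Suc N) n' j = w j" if j: "j \<in> {1..Suc N}" for j
  proof (cases "j = 1")
    case True
    then show ?thesis using slope_1 s by metis
  next
    case False
    then have "j = Suc (j - 1)" "j - 1 \<in> {1..N}" using j by auto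
    then obtain i where i: "j = Suc i" "i \<in> {1..N}" by blast
    have "slope N (\<lambda>k. n' (Suc k)) i = slope N n i" by (rule slope_cong) (simp add: n'_def)
    then show ?thesis using i slope_Suc[of i N n'] s n by simp
  qed
  then show ?case by blast
qed simp

section \<open>The lattice as the stabilizer of a word\<close>

lemma Fmat_sum:
  assumes j: "j \<in> {1..N}" and \<alpha>: "\<And>k. k \<in> {1..N} \<Longrightarrow> 0 < \<alpha> k \<and> \<alpha> k dvd m k \<and> int (\<alpha> k) dvd vac L N m k"
  shows "(\<Sum>k=1..N. Fmat L N m \<alpha> j k * x k) =
    x j * (vac L N m j div int (\<alpha> j)) + 2 * slope N (\<lambda>k. x k * int (m k div \<alpha> k)) j"
proof -
  have F: "Fmat L N m \<alpha> j k * x k = (if j = k then x j * (vac L N m j div int (\<alpha> j)) else 0) +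
      2 * (x k * int (m k div \<alpha> k) * int (min j k))" if k: "k \<in> {1..N}" for k
  proof -
    obtain m' where m': "m k = \<alpha> k * m'" using \<alpha>[OF k] by (metis dvd_def)
    obtain v where v: "vac L N m k = int (\<alpha> k) * v" using \<alpha>[OF k] by (metis dvd_def)
    have a: "int (\<alpha> k) \<noteq> 0" using \<alpha>[OF k] by simp
    have "Fmat L N m \<alpha> j k = (int (\<alpha> k) * ((if j = k then v else 0) + 2 * int (min j k) * int m')) div int (\<alpha> k)"
      unfolding Fmat_def Bmat_def v unfolding m' by (simp add: algebra_simps)
    also have "\<dots> = (if j = k then v else 0) + 2 * int (min j k) * int m'"
      by (rule nonzero_mult_div_cancel_left[OF a])
    finally have F: "Fmat L N m \<alpha> j k = (if j = k then v else 0) + 2 * int (min j k) * int m'" .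
    have "m k div \<alpha> k = m'" "vac L N m k div int (\<alpha> k) = v" using m' v a by simp_all
    then show ?thesis unfolding F by (auto simp: algebra_simps)
  qed
  have "(\<Sum>k=1..N. Fmat L N m \<alpha> j k * x k) = (\<Sum>k=1..N. (if j = k then x j * (vac L N m j div int (\<alpha> j)) else 0) +
      2 * (x k * int (m k div \<alpha> k) * int (min j k)))"
    by (rule sum.cong[OF refl F])
  then show ?thesis using j by (simp add: sum.distrib slope_def sum_distrib_left)
qed

lemma mem_lattice_iff:
  assumes u: "u \<in> ZN N" and \<alpha>: "\<And>k. k \<in> {1..N} \<Longrightarrow> 0 < \<alpha> k \<and> \<alpha> k dvd m k \<and> int (\<alpha> k) dvd vac L N m k"
  shows "u \<in> lattice L N m \<alpha> \<longleftrightarrow> (\<exists>x. \<forall>j\<in>{1..N}. u j = x j * (vac L N m j div int (\<alpha> j)) +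
    2 * slope N (\<lambda>k. x k * int (m k div \<alpha> k)) j)"
proof
  assume "u \<in> lattice L N m \<alpha>"
  then obtain x where "u = (\<lambda>j. if j \<in> {1..N} then (\<Sum>k=1..N. Fmat L N m \<alpha> j k * x k) else 0)"
    by (auto simp: lattice_def)
  then show "\<exists>x. \<forall>j\<in>{1..N}. u j = x j * (vac L N m j div int (\<alpha> j)) +
    2 * slope N (\<lambda>k. x k * int (m k div \<alpha> k)) j" using Fmat_sum[OF _ \<alpha>] by (intro exI[of _ x]) simp
next
  assume "\<exists>x. \<forall>j\<in>{1..N}. u j = x j * (vac L N m j div int (\<alpha> j)) + 2 * slope N (\<lambda>k. x k * int (m k div \<alpha> k)) j"
  then obtain x where x: "\<And>j. j \<in> {1..N} \<Longrightarrow>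
    u j = x j * (vac L N m j div int (\<alpha> j)) + 2 * slope N (\<lambda>k. x k * int (m k div \<alpha> k)) j" by blast
  define y where "y j = (if j \<in> {1..N} then x j else 0)" for j
  have "u j = (if j \<in> {1..N} then (\<Sum>k=1..N. Fmat L N m \<alpha> j k * y k) else 0)" for j
  proof (cases "j \<in> {1..N}")
    case True
    have "(\<Sum>k=1..N. Fmat L N m \<alpha> j k * y k) = (\<Sum>k=1..N. Fmat L N m \<alpha> j k * x k)"
      by (rule sum.cong) (auto simp: y_def)
    then show ?thesis using True Fmat_sum[OF True \<alpha>, of x] x[OF True] by simp
  next
    case False
    then show ?thesis using u by (auto simp: ZN_def)
  qed
  then have "u = (\<lambda>j. if j \<in> {1..N} then (\<Sum>k=1..N. Fmat L N m \<alpha> j k * y k) else 0)" by blast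
  moreover have "y \<in> ZN N" by (auto simp: y_def ZN_def)
  ultimately show "u \<in> lattice L N m \<alpha>" unfolding lattice_def by blast
qed

lemma ZN_diff: "u \<in> ZN N \<Longrightarrow> v \<in> ZN N \<Longrightarrow> (\<lambda>j. u j - v j) \<in> ZN N"
  unfolding ZN_def mem_Collect_eq by (metis diff_self)

lemma ZN_add: "u \<in> ZN N \<Longrightarrow> v \<in> ZN N \<Longrightarrow> (\<lambda>j. u j + v j) \<in> ZN N"
  unfolding ZN_def mem_Collect_eq by (metis add_0)

lemma translated_word_eq_iff:
  assumes L: "0 < L" and r: "rigged (int L) N m J"
    and \<alpha>: "\<And>k. k \<in> {1..N} \<Longrightarrow> 0 < \<alpha> k \<and> \<alpha> k dvd m k \<and> int (\<alpha> k) dvd vac L N m k"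
    and J: "\<And>k. k \<in> {1..N} \<Longrightarrow> J k \<in> Jbar_alpha (\<alpha> k) (m k) (vac L N m k)"
    and w: "w \<in> ZN N" "w' \<in> ZN N"
  shows "word L (assemble N (\<lambda>j i. J j i + w' j)) = word L (assemble N (\<lambda>j i. J j i + w j)) \<longleftrightarrow>
    (\<lambda>j. w' j - w j) \<in> lattice L N m \<alpha>"
proof -
  have per: "(\<forall>i. J j (i + a) = J j i + c) \<longleftrightarrow> (\<exists>x. a = x * int (m j div \<alpha> j) \<and> c = x * (vac L N m j div int (\<alpha> j)))"
    if "j \<in> {1..N}" for j a c
    using Jbar_alpha_quasi_period_iff[OF J[OF that]] \<alpha>[OF that] r that unfolding rigged_def by blast
  have "word L (assemble N (\<lambda>j i. J j i + w' j)) = word L (assemble N (\<lambda>j i. J j i + w j)) \<longleftrightarrow>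
    (\<exists>a. \<forall>j\<in>{1..N}. \<forall>i. J j i + w' j = J j (i + a j) + w j + 2 * slope N a j)"
    by (rule word_assemble_eq_iff[OF rigged_translate[OF r] rigged_translate[OF r] L])
  also have "\<dots> \<longleftrightarrow> (\<exists>a. \<forall>j\<in>{1..N}. \<forall>i. J j (i + a j) = J j i + (w' j - w j - 2 * slope N a j))"
    by (intro arg_cong[of _ _ Ex] ext ball_cong refl all_cong1) linarith
  also have "\<dots> \<longleftrightarrow> (\<exists>a. \<forall>j\<in>{1..N}. \<exists>x. a j = x * int (m j div \<alpha> j) \<and>
      w' j - w j - 2 * slope N a j = x * (vac L N m j div int (\<alpha> j)))"
    using per by simp
  also have "\<dots> \<longleftrightarrow> (\<exists>x. \<forall>j\<in>{1..N}. w' j - w j = x j * (vac L N m j div int (\<alpha> j)) +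
    2 * slope N (\<lambda>k. x k * int (m k div \<alpha> k)) j)" (is "?l \<longleftrightarrow> ?r")
  proof
    assume ?l
    then obtain a where "\<forall>j\<in>{1..N}. \<exists>x. a j = x * int (m j div \<alpha> j) \<and>
      w' j - w j - 2 * slope N a j = x * (vac L N m j div int (\<alpha> j))" by blast
    from bchoice[OF this] obtain x where x: "\<And>j. j \<in> {1..N} \<Longrightarrow> a j = x j * int (m j div \<alpha> j)"
      "\<And>j. j \<in> {1..N} \<Longrightarrow> w' j - w j - 2 * slope N a j = x j * (vac L N m j div int (\<alpha> j))" by blast
    have "slope N a j = slope N (\<lambda>k. x k * int (m k div \<alpha> k)) j" for j by (rule slope_cong[OF x(1)])
    then show ?r using x(2) by (intro exI[of _ x] ballI) (simp add: diff_eq_eq)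
  next
    assume ?r
    then obtain x where "\<And>j. j \<in> {1..N} \<Longrightarrow> w' j - w j = x j * (vac L N m j div int (\<alpha> j)) +
      2 * slope N (\<lambda>k. x k * int (m k div \<alpha> k)) j" by blast
    then show ?l by (intro exI[of _ "\<lambda>k. x k * int (m k div \<alpha> k)"] ballI) auto
  qed
  also have "\<dots> \<longleftrightarrow> (\<lambda>j. w' j - w j) \<in> lattice L N m \<alpha>"
    by (rule mem_lattice_iff[OF ZN_diff[OF w(2,1)] \<alpha>, symmetric])
  finally show ?thesis .
qed

lemma orbit_torus_bijection:
  fixes L N :: nat and m \<alpha> :: "nat \<Rightarrow> nat"
  assumes L: "0 < L" and r: "rigged (int L) N m J" and path: "word L (assemble N J) \<in> paths L"
    and \<alpha>: "\<And>k. k \<in> {1..N} \<Longrightarrow> 0 < \<alpha> k \<and> \<alpha> k dvd m k \<and> int (\<alpha> k) dvd vac L N m k"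
    and J: "\<And>k. k \<in> {1..N} \<Longrightarrow> J k \<in> Jbar_alpha (\<alpha> k) (m k) (vac L N m k)"
  defines "p \<equiv> word L (assemble N J)"
  shows "\<exists>\<Phi>. bij_betw \<Phi> (orbit L N p) (torus L N m \<alpha>) \<and>
           (\<forall>q\<in>orbit L N p. \<forall>n\<in>ZN N.
              \<Phi> (act L N n q) = tshift (\<lambda>j. \<Sum>k=1..N. n k * hvec N k j) (\<Phi> q))"
proof -
  define W where "W w = word L (assemble N (\<lambda>j i. J j i + w j))" for w
  define h where "h n = (\<lambda>j. \<Sum>k=1..N. n k * hvec N k j)" for n
  have hs: "h n j = (if j \<in> {1..N} then slope N n j else 0)" for n j
    by (auto simp: h_def hvec_def slope_def)
  have hZ: "h n \<in> ZN N" for n using hs by (auto simp: ZN_def)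
  have Wh: "word L (assemble N (\<lambda>j i. J j i + w j + slope N n j)) = W (\<lambda>j. w j + h n j)" for w n
    unfolding W_def by (intro arg_cong[of _ _ "word L"] assemble_cong) (auto simp: hs)
  have Weq: "W w' = W w \<longleftrightarrow> (\<lambda>j. w' j - w j) \<in> lattice L N m \<alpha>" if "w \<in> ZN N" "w' \<in> ZN N" for w w'
    unfolding W_def by (rule translated_word_eq_iff[OF L r \<alpha> J that])
  have Z0: "(\<lambda>j. 0) \<in> ZN N" by (simp add: ZN_def)
  have actp: "act L N n p = W (h n)" "W (h n) \<in> paths L" for n
    using act_word[OF r path, of N n] Wh[of "\<lambda>j. 0" n] unfolding p_def by simp_all
  \<comment> \<open>By unimodularity every integer translation of the riggings is a time evolution,
    so the orbit is the full image of \<open>W\<close> on \<open>ZN N\<close>.\<close>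
  have ex: "\<exists>n\<in>ZN N. h n = w" if w: "w \<in> ZN N" for w
  proof -
    obtain n where n: "\<And>j. j \<in> {1..N} \<Longrightarrow> slope N n j = w j" using slope_surj by blast
    define n' where "n' k = (if k \<in> {1..N} then n k else 0)" for k
    have "slope N n' j = slope N n j" for j by (rule slope_cong) (simp add: n'_def)
    then have "h n' = w" using n w by (auto simp: hs fun_eq_iff ZN_def)
    moreover have "n' \<in> ZN N" by (auto simp: n'_def ZN_def)
    ultimately show ?thesis by blast
  qed
  have orb: "orbit L N p = W ` ZN N"
    unfolding orbit_def actp using ex hZ by blast
  have Wpath: "W w \<in> paths L" if "w \<in> ZN N" for w using ex[OF that] actp(2) by blast
  have actW: "act L N n (W w) = W (\<lambda>j. w j + h n j)" if "w \<in> ZN N" for w n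
    using act_word(1)[OF rigged_translate[OF r], of w N n] Wpath[OF that] Wh[of w n] unfolding W_def by simp
  \<comment> \<open>A path is sent to the set of all translations producing it; such a fibre of
    \<open>W\<close> is a coset of the lattice, with no representative to choose.\<close>
  define \<Phi> where "\<Phi> q = {w \<in> ZN N. W w = q}" for q
  have cls: "\<Phi> (W w) = torus_rel L N m \<alpha> `` {w}" if w: "w \<in> ZN N" for w
  proof -
    have "W w' = W w \<longleftrightarrow> (\<lambda>j. w j - w' j) \<in> lattice L N m \<alpha>" if "w' \<in> ZN N" for w'
      using Weq[OF that w] by auto
    then show ?thesis using w by (auto simp: \<Phi>_def torus_rel_def)
  qed
  have "bij_betw \<Phi> (orbit L N p) (torus L N m \<alpha>)"
  proof (rule bij_betw_imageI)
    show "inj_on \<Phi> (orbit L N p)"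
      unfolding orb by (rule inj_onI) (auto simp: \<Phi>_def)
    show "\<Phi> ` orbit L N p = torus L N m \<alpha>"
      unfolding orb torus_def quotient_def using cls by auto
  qed
  moreover have "\<Phi> (act L N n q) = tshift (h n) (\<Phi> q)" if q: "q \<in> orbit L N p" for q n
  proof -
    obtain w where w: "w \<in> ZN N" "q = W w" using q orb by blast
    have iff: "W v = W (\<lambda>j. w j + h n j) \<longleftrightarrow> W (\<lambda>j. v j - h n j) = W w" if "v \<in> ZN N" for v
      using Weq[OF ZN_add[OF w(1) hZ] that, of n] Weq[OF w(1) ZN_diff[OF that hZ], of n]
      by (simp add: algebra_simps)
    show ?thesis
    proof (rule set_eqI)
      fix v
      have "v \<in> \<Phi> (act L N n q) \<longleftrightarrow> v \<in> ZN N \<and> W (\<lambda>j. v j - h n j) = W w"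
        unfolding w(2) actW[OF w(1)] \<Phi>_def using iff by blast
      also have "\<dots> \<longleftrightarrow> v \<in> tshift (h n) (\<Phi> q)"
      proof
        assume v: "v \<in> ZN N \<and> W (\<lambda>j. v j - h n j) = W w"
        then have "(\<lambda>j. v j - h n j) \<in> \<Phi> q" using ZN_diff[OF _ hZ] w(2) by (simp add: \<Phi>_def)
        then show "v \<in> tshift (h n) (\<Phi> q)"
          unfolding tshift_def by (intro image_eqI[of v _ "\<lambda>j. v j - h n j"]) simp_all
      next
        assume "v \<in> tshift (h n) (\<Phi> q)"
        then obtain u where "u \<in> ZN N" "W u = W w" "v = (\<lambda>j. u j + h n j)"
          unfolding tshift_def \<Phi>_def w(2) by blast
        then show "v \<in> ZN N \<and> W (\<lambda>j. v j - h n j) = W w" using ZN_add[OF _ hZ] by simp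
      qed
      finally show "v \<in> \<Phi> (act L N n q) \<longleftrightarrow> v \<in> tshift (h n) (\<Phi> q)" .
    qed
  qed
  ultimately show ?thesis unfolding h_def by blast
qed

section \<open>Multisets of run ends\<close>

text \<open>Multisets are compared by cumulative counts, because these can be read off the counting
  functions \<open>Y\<close>, \<open>Z\<close> and \<open>K\<close>.\<close>

lemma int_mset_eqI:
  fixes M N :: "int multiset"
  assumes "\<And>x. size (filter_mset (\<lambda>y. y \<le> x) M) = size (filter_mset (\<lambda>y. y \<le> x) N)"
  shows "M = N"
proof (rule multiset_eqI)
  have c: "size (filter_mset (\<lambda>y. y \<le> x) P) = size (filter_mset (\<lambda>y. y \<le> x - 1) P) + count P x" for x and P :: "int multiset"
    by (induction P) auto
  fix x show "count M x = count N x" using c[of x M] c[of x N] assms[of x] assms[of "x - 1"] by linarith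
qed

lemma size_filter_le_enum:
  assumes "\<And>i. 1 \<le> i \<Longrightarrow> i \<le> n \<Longrightarrow> f i \<le> x \<longleftrightarrow> int i \<le> k"
  shows "size (filter_mset (\<lambda>y. y \<le> x) (mset (map f [1..<n + 1]))) = min n (nat k)"
  using assms
proof (induction n)
  case (Suc n)
  have "size (filter_mset (\<lambda>y. y \<le> x) (mset (map f [1..<n + 1]))) = min n (nat k)"
    by (rule Suc.IH) (use Suc.prems in simp)
  moreover have "f (Suc n) \<le> x \<longleftrightarrow> int (Suc n) \<le> k" using Suc.prems by simp
  ultimately show ?case by (auto simp: min_def)
qed simp

lemma zip_map_self: "zip xs (map f xs) = map (\<lambda>x. (x, f x)) xs"
  by (induction xs) auto

lemma sorted_list_of_enum:
  fixes f :: "nat \<Rightarrow> int"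
  assumes "\<And>i j. 1 \<le> i \<Longrightarrow> i \<le> j \<Longrightarrow> j \<le> n \<Longrightarrow> f i \<le> f j"
  shows "sorted_list_of_multiset (mset (map f [1..<n + 1])) = map f [1..<n + 1]"
proof -
  have "sorted (map f [1..<n + 1])"
    unfolding sorted_iff_nth_mono_less by (auto simp del: upt_Suc simp: nth_append intro!: assms)
  then show ?thesis by (simp only: sorted_list_of_multiset_mset sorted_sort_id)
qed

lemma Op1_enum:
  assumes "\<And>i j. 1 \<le> i \<Longrightarrow> i \<le> j \<Longrightarrow> j \<le> n \<Longrightarrow> f i \<le> f j"
  shows "Op1 (mset (map f [1..<n + 1])) = mset (map (\<lambda>i. f i - (2 * int i - 1)) [1..<n + 1])"
proof -
  have sz: "size (mset (map f [1..<n + 1])) = n" by (simp only: size_mset length_map length_upt diff_add_inverse2)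
  have s: "sorted_list_of_multiset (mset (map f [1..<n + 1])) = map f [1..<n + 1]"
    by (rule sorted_list_of_enum) (rule assms)
  show ?thesis unfolding Op1_def sz s by (simp only: zip_map_self map_map comp_def case_prod_conv)
qed

lemma Op2_enum:
  assumes "\<And>i j. 1 \<le> i \<Longrightarrow> i \<le> j \<Longrightarrow> j \<le> n \<Longrightarrow> f i \<le> f j"
  shows "Op2 (mset (map f [1..<n + 1])) = mset (map (\<lambda>i. f i - 2 * int i) [1..<n + 1])"
proof -
  have sz: "size (mset (map f [1..<n + 1])) = n" by (simp only: size_mset length_map length_upt diff_add_inverse2)
  have s: "sorted_list_of_multiset (mset (map f [1..<n + 1])) = map f [1..<n + 1]"
    by (rule sorted_list_of_enum) (rule assms)
  show ?thesis unfolding Op2_def sz s by (simp only: zip_map_self map_map comp_def case_prod_conv)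
qed

text \<open>Positions where a run of 1s (\<open>\<delta> = 1\<close>) or of 2s (\<open>\<delta> = 0\<close>) ends.\<close>
definition run_ends :: "int \<Rightarrow> int \<Rightarrow> (int \<Rightarrow> int) \<Rightarrow> int multiset" where
  "run_ends \<delta> L Y = mset_set {x \<in> {1..L}. Y x \<noteq> Y (x - 1) \<and> even (Y x + \<delta>)}"

text \<open>Ends alternate, starting with a run of 1s as \<open>Y 0 = 0\<close>:
  \<open>\<delta> = 1\<close> rounds half the count up, \<open>\<delta> = 0\<close> down. The
  argument is clamped because only one period is listed.\<close>

lemma size_run_ends_le:
  assumes st: "\<And>x. Y (x + 1) = Y x \<or> Y (x + 1) = Y x + 1" and Y0: "Y 0 = 0" and \<delta>: "\<delta> \<in> {0, 1}"
    and L: "0 \<le> L"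
  shows "int (size (filter_mset (\<lambda>y. y \<le> x) (run_ends \<delta> L Y))) = (Y (max 0 (min x L)) + \<delta>) div 2"
proof -
  define u where "u = max 0 (min x L)"
  have "{t \<in> {t \<in> {1..L}. Y t \<noteq> Y (t - 1) \<and> even (Y t + \<delta>)}. t \<le> x} = {t \<in> {1..u}. Y t \<noteq> Y (t - 1) \<and> even (Y t + \<delta>)}"
    by (auto simp: u_def)
  then have s: "size (filter_mset (\<lambda>y. y \<le> x) (run_ends \<delta> L Y)) = card {t \<in> {1..u}. Y t \<noteq> Y (t - 1) \<and> even (Y t + \<delta>)}"
    unfolding run_ends_def
    by (subst filter_mset_mset_set) (auto intro: finite_subset[of _ "{1..L}"])
  have "int (card {t \<in> {1..u}. Y t \<noteq> Y (t - 1) \<and> even (Y t + \<delta>)}) = (Y u + \<delta>) div 2" if "0 \<le> u" for u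
    using that
  proof (induction u rule: int_ge_induct)
    case base
    then show ?case using Y0 \<delta> by auto
  next
    case (step u)
    let ?S = "\<lambda>u. {t \<in> {1..u}. Y t \<noteq> Y (t - 1) \<and> even (Y t + \<delta>)}"
    have "{1..u + 1} = insert (u + 1) {1..u}" using step.hyps by auto
    then have "?S (u + 1) = (if Y (u + 1) \<noteq> Y u \<and> even (Y (u + 1) + \<delta>) then insert (u + 1) (?S u) else ?S u)"
      by auto
    moreover have "finite (?S u)" "u + 1 \<notin> ?S u" by (rule finite_subset[of _ "{1..u}"]) auto
    ultimately have "int (card (?S (u + 1))) =
        int (card (?S u)) + (if Y (u + 1) \<noteq> Y u \<and> even (Y (u + 1) + \<delta>) then 1 else 0)"
      by (simp only: card_insert_disjoint split: if_split) simp
    also have "\<dots> = (Y (u + 1) + \<delta>) div 2" using step.IH st[of u] by presburger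
    finally show ?case .
  qed
  then show ?thesis using s by (simp add: u_def)
qed

text \<open>\<open>n\<close> is the number of runs of 2s per period and \<open>h\<close> the height,
  the surplus of 1s over 2s counted from cell 0. Its bound on the whole right half line is the form
  of the ballot property that elimination preserves.\<close>

definition level :: "int \<Rightarrow> nat \<Rightarrow> (int \<Rightarrow> int) \<Rightarrow> (int \<Rightarrow> int) \<Rightarrow> bool" where
  "level L n Y h \<longleftrightarrow> 0 < L \<and> (\<forall>x. Y (x + 1) = Y x \<or> Y (x + 1) = Y x + 1) \<and>
    (\<forall>x. Y (x + L) = Y x + 2 * int n) \<and> Y 0 = 0 \<and> h 0 = 0 \<and>
    (\<forall>x. h (x + 1) = h x + (if even (Y x) then 1 else - 1)) \<and> (\<forall>x\<ge>0. 0 \<le> h x)"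

text \<open>By alternation the \<open>i\<close>-th smallest elements of the two multisets are
  \<open>y (2 * i - 1)\<close> and \<open>y (2 * i)\<close>. So \<open>Op1\<close> and
  \<open>Op2\<close> subtract from each end exactly its label, which shortens every run by one
  letter.\<close>

lemma run_ends_enum:
  assumes st: "\<And>x. Y (x + 1) = Y x \<or> Y (x + 1) = Y x + 1" and Y0: "Y 0 = 0" and YL: "Y L = 2 * int n"
    and L: "0 \<le> L" and \<delta>: "\<delta> \<in> {0, 1}" and y: "\<And>i x. i \<le> Y x \<longleftrightarrow> y i \<le> x"
  shows "run_ends \<delta> L Y = mset (map (\<lambda>i. y (2 * int i - \<delta>)) [1..<n + 1])"
proof (rule int_mset_eqI)
  fix x
  have mY: "mono Y" using st by (intro int_step_mono) (metis order_refl zle_add1_eq_le less_le)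
  have "size (filter_mset (\<lambda>z. z \<le> x) (mset (map (\<lambda>i. y (2 * int i - \<delta>)) [1..<n + 1]))) = min n (nat ((Y x + \<delta>) div 2))"
  proof (rule size_filter_le_enum)
    fix i show "y (2 * int i - \<delta>) \<le> x \<longleftrightarrow> int i \<le> (Y x + \<delta>) div 2"
      unfolding y[symmetric] by presburger
  qed
  moreover have "(Y (max 0 (min x L)) + \<delta>) div 2 = int (min n (nat ((Y x + \<delta>) div 2)))"
  proof -
    consider "x < 0" | "0 \<le> x" "x \<le> L" | "L < x" by linarith
    then show ?thesis
    proof cases
      case 1
      then have "Y x \<le> 0" using monoD[OF mY, of x 0] Y0 by simp
      then show ?thesis using 1 \<delta> L Y0 by auto
    next
      case 2
      then have "0 \<le> Y x" "Y x \<le> 2 * int n" using monoD[OF mY, of x L] monoD[OF mY, of 0 x] Y0 YL by auto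
      then show ?thesis using 2 \<delta> by auto
    next
      case 3
      then have "2 * int n \<le> Y x" using monoD[OF mY, of L x] YL by simp
      then show ?thesis using 3 \<delta> L YL by auto
    qed
  qed
  ultimately show "size (filter_mset (\<lambda>z. z \<le> x) (run_ends \<delta> L Y)) =
    size (filter_mset (\<lambda>z. z \<le> x) (mset (map (\<lambda>i. y (2 * int i - \<delta>)) [1..<n + 1])))"
    using size_run_ends_le[OF st Y0 \<delta> L, of x] by linarith
qed

lemma run_ends_disjoint: "run_ends 1 L Y \<inter># run_ends 0 L Y = {#}"
proof -
  have "finite {x. 1 \<le> x \<and> x \<le> L \<and> P x}" for P by (rule finite_subset[of _ "{1..L}"]) auto
  then show ?thesis unfolding run_ends_def by (auto simp: disjunct_not_in)
qed

lemma cumulative_ex: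
  fixes d :: "int \<Rightarrow> int"
  shows "\<exists>F. F 0 = 0 \<and> (\<forall>x. F (x + 1) = F x + d (x + 1))"
proof (intro exI[of _ "\<lambda>x. (\<Sum>t\<in>{1..x}. d t) - (\<Sum>t\<in>{x + 1..0}. d t)"] conjI allI)
  fix x :: int
  show "(\<Sum>t\<in>{1..x + 1}. d t) - (\<Sum>t\<in>{x + 1 + 1..0}. d t) = (\<Sum>t\<in>{1..x}. d t) - (\<Sum>t\<in>{x + 1..0}. d t) + d (x + 1)"
  proof (cases "0 \<le> x")
    case True
    then have "{1..x + 1} = insert (x + 1) {1..x}" "{x + 1 + 1..0} = {}" "{x + 1..0} = {}" by auto
    then show ?thesis by simp
  next
    case False
    then have "{x + 1..0} = insert (x + 1) {x + 1 + 1..0}" "{1..x + 1} = {}" "{1..x} = {}" by auto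
    then show ?thesis by simp
  qed
qed simp

text \<open>\<open>Y\<close> counts the changes of \<open>Q\<close>; over a period their number is
  even because \<open>Q\<close> returns to its value. It produces the word that survives an
  elimination, of which only the parity is known at first.\<close>

lemma parity_lift:
  fixes Q :: "int \<Rightarrow> bool"
  assumes Q: "\<And>x. Q (x + p) = Q x" "\<not> Q 0" "0 < p"
  shows "\<exists>Y (n::nat). Y 0 = 0 \<and> (\<forall>x. Y (x + 1) = Y x \<or> Y (x + 1) = Y x + 1) \<and>
    (\<forall>x. odd (Y x) = Q x) \<and> (\<forall>x. Y (x + p) = Y x + 2 * int n)"
proof -
  define d where "d x = (if Q x \<noteq> Q (x - 1) then 1 else 0 :: int)" for x
  obtain Y where Y: "Y 0 = 0" "\<And>x. Y (x + 1) = Y x + d (x + 1)" using cumulative_ex by metis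
  have odd: "odd (Y x) = Q x" for x
  proof (induction x rule: int_induct[where k=0])
    case base
    then show ?case using Y(1) Q(2) by simp
  next
    case (step1 x)
    then show ?case using Y(2)[of x] by (auto simp: d_def)
  next
    case (step2 x)
    then show ?case using Y(2)[of "x - 1"] by (auto simp: d_def split: if_splits)
  qed
  have "d (x + p) = d x" for x using Q(1)[of x] Q(1)[of "x - 1"] by (simp add: d_def algebra_simps)
  then have "Y (x + 1 + p) - Y (x + 1) = Y (x + p) - Y x" for x
    using Y(2)[of x] Y(2)[of "x + p"] by (simp add: algebra_simps) (metis add.commute add.left_commute)
  then have c: "Y (x + p) - Y x = Y (0 + p) - Y 0" for x by (rule int_step_const)
  have m: "mono Y" using Y(2) by (intro int_step_mono) (simp add: d_def)
  have "even (Y p)" using odd[of p] Q(1)[of 0] Q(2) by simp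
  then obtain k where k: "Y p = 2 * k" by (rule evenE)
  moreover have "0 \<le> Y p" using monoD[OF m, of 0 p] Q(3) Y(1) by simp
  ultimately have "Y p = 2 * int (nat k)" by simp
  then have "Y (x + p) = Y x + 2 * int (nat k)" for x using c[of x] Y(1) by simp
  moreover have "Y (x + 1) = Y x \<or> Y (x + 1) = Y x + 1" for x using Y(2)[of x] by (simp add: d_def)
  ultimately show ?thesis using Y(1) odd by blast
qed

section \<open>One elimination step\<close>

lemma sequence_of_counting_ex:
  fixes Y :: "int \<Rightarrow> int"
  assumes m: "mono Y" and p: "0 < q" "0 < L" and per: "\<And>x. Y (x + L) = Y x + q"
  shows "\<exists>y. \<forall>i x. i \<le> Y x \<longleftrightarrow> y i \<le> x"
proof -
  have "\<exists>z. \<forall>x. i \<le> Y x \<longleftrightarrow> z \<le> x" for i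
  proof (rule int_cut)
    have ge: "\<bar>i - Y 0\<bar> \<le> \<bar>i - Y 0\<bar> * q" using p(1) by (simp add: mult_le_cancel_left1)
    show "i \<le> Y x'" if "i \<le> Y x" "x \<le> x'" for x x' using monoD[OF m that(2)] that(1) by linarith
    show "i \<le> Y (0 + \<bar>i - Y 0\<bar> * L)"
      unfolding quasi_periodic_multiple[of Y L q, OF per] using ge by linarith
    show "\<not> i \<le> Y (0 + (- \<bar>i - Y 0\<bar> - 1) * L)"
      unfolding quasi_periodic_multiple[of Y L q, OF per] using ge p(1) by (simp add: algebra_simps)
  qed
  then show ?thesis by metis
qed

locale elimination =
  fixes L :: int and n :: nat and Y h y z :: "int \<Rightarrow> int"
  assumes lev: "level L n Y h" and n0: "0 < n" and y: "\<And>i x. i \<le> Y x \<longleftrightarrow> y i \<le> x"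
  defines "z \<equiv> \<lambda>i. y i - i"
begin

lemma st: "Y (x + 1) = Y x \<or> Y (x + 1) = Y x + 1"
  and per: "Y (x + L) = Y x + 2 * int n" and Y0: "Y 0 = 0" and h0: "h 0 = 0" and L0: "0 < L"
  and hst: "h (x + 1) = h x + (if even (Y x) then 1 else - 1)" and hpos: "0 \<le> x \<Longrightarrow> 0 \<le> h x"
  using lev by (auto simp: level_def)

lemma z_mono: "mono z"
proof (rule int_step_mono)
  fix i
  have "y i \<le> y (i + 1) - 1"
    using y[of "i + 1" "y (i + 1)"] y[of i "y (i + 1) - 1"] st[of "y (i + 1) - 1"] by auto
  then show "z i \<le> z (i + 1)" by (simp add: z_def)
qed

lemma z_period: "z (i + 2 * int n) = z i + (L - 2 * int n)"
proof -
  have "y (i + 2 * int n) = y i + L"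
  proof (rule int_le_iff_eq)
    fix x
    show "y (i + 2 * int n) \<le> x \<longleftrightarrow> y i + L \<le> x"
      using y[of "i + 2 * int n" x] y[of i "x - L"] per[of "x - L"] by auto
  qed
  then show ?thesis by (simp add: z_def)
qed

lemma z1: "0 \<le> z 1" using y[of 1 0] Y0 by (simp add: z_def)

lemma z2n: "z (2 * int n) \<le> L - 2 * int n" using y[of "2 * int n" L] per[of 0] Y0 by (simp add: z_def)

lemma period_nonneg: "0 \<le> L - 2 * int n"
  using z1 z2n monoD[OF z_mono, of 1 "2 * int n"] n0 by simp

lemma YL: "Y L = 2 * int n" using per[of 0] Y0 by simp

lemma y_mono: "i \<le> j \<Longrightarrow> y i \<le> y j"
  using y by (meson order_refl order_trans)

lemma Op1_run_ends: "Op1 (run_ends 1 L Y) = mset (map (\<lambda>i. z (2 * int i - 1)) [1..<n + 1])"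
proof -
  have e: "run_ends 1 L Y = mset (map (\<lambda>i. y (2 * int i - 1)) [1..<n + 1])"
    by (rule run_ends_enum[OF st Y0 YL _ _ y]) (use L0 in auto)
  have "Op1 (run_ends 1 L Y) = mset (map (\<lambda>i. y (2 * int i - 1) - (2 * int i - 1)) [1..<n + 1])"
    unfolding e by (rule Op1_enum) (simp add: y_mono)
  then show ?thesis by (simp only: z_def)
qed

lemma Op2_run_ends: "Op2 (run_ends 0 L Y) = mset (map (\<lambda>i. z (2 * int i - 0)) [1..<n + 1])"
proof -
  have e: "run_ends 0 L Y = mset (map (\<lambda>i. y (2 * int i - 0)) [1..<n + 1])"
    by (rule run_ends_enum[OF st Y0 YL _ _ y]) (use L0 in auto)
  have "Op2 (run_ends 0 L Y) = mset (map (\<lambda>i. y (2 * int i - 0) - 2 * int i) [1..<n + 1])"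
    unfolding e by (rule Op2_enum) (simp add: y_mono)
  then show ?thesis by (simp only: z_def diff_zero)
qed

lemma inflate_eqY:
  assumes "mono Y'" "mono J" "\<And>i. merge_seq Y' J i = z i"
  shows "inflate Y' J = Y"
proof
  fix x show "inflate Y' J x = Y x"
    by (rule int_ge_iff_eq) (simp add: le_inflate[OF assms(1,2)] assms(3) y z_def)
qed

text \<open>The right end is included: \<open>z (i + 1) + i\<close> is the last cell before
  \<open>y (i + 1)\<close>.\<close>

lemma letter_at: "z i \<le> \<xi> \<Longrightarrow> \<xi> \<le> z (i + 1) \<Longrightarrow> Y (\<xi> + i) = i"
  using y[of i "\<xi> + i"] y[of "i + 1" "\<xi> + i"] by (simp add: z_def)

text \<open>A run of length zero makes the word alternate, which does not contribute to the height.\<close>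
lemma height_vertical:
  assumes "i0 \<le> i1" "\<And>i. i0 \<le> i \<Longrightarrow> i < i1 \<Longrightarrow> z i \<le> \<xi> \<and> \<xi> \<le> z (i + 1)"
  shows "h (\<xi> + i1) - i1 mod 2 = h (\<xi> + i0) - i0 mod 2"
  using assms
proof (induction i1 rule: int_ge_induct)
  case (step i)
  have "h (\<xi> + i) - i mod 2 = h (\<xi> + i0) - i0 mod 2" by (rule step.IH) (use step.prems in simp)
  moreover have "Y (\<xi> + i) = i" by (rule letter_at) (use step in auto)
  ultimately show ?case using hst[of "\<xi> + i"] by (simp add: add.assoc) presburger
qed simp

text \<open>Here the ballot condition enters: no run end is carried across the origin.\<close>
lemma first_even:
  assumes Z: "\<And>i x. i \<le> Z x \<longleftrightarrow> z i \<le> x"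
  shows "0 \<le> Z 0" "even (Z 0)" "h (Z 0) = 0"
proof -
  show Z0: "0 \<le> Z 0" using Z[of 0 0] Y0 y[of 0 0] by (simp add: z_def)
  have zi: "0 \<le> z (i + 1)" if "0 \<le> i" for i using z1 monoD[OF z_mono, of 1 "i + 1"] that by simp
  have "h (0 + Z 0) - Z 0 mod 2 = h (0 + 0) - 0 mod 2"
    by (rule height_vertical[OF Z0]) (use zi in \<open>simp flip: Z\<close>)
  then have hZ: "h (Z 0) = Z 0 mod 2" using h0 by simp
  have z0: "z (Z 0) \<le> 0" "0 < z (Z 0 + 1)" using Z[of "Z 0" 0] Z[of "Z 0 + 1" 0] by auto
  show e: "even (Z 0)"
  proof (rule ccontr)
    assume o: "odd (Z 0)"
    \<comment> \<open>For an odd label the height at cell \<open>Z 0\<close> would be 1 and two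
      letters 2 would follow, which leads to height -1.\<close>
    have "Y (0 + Z 0) = Z 0" "Y (1 + Z 0) = Z 0" by (rule letter_at; use z0 in simp)+
    then have "h (Z 0 + 1) = 0" "h (Z 0 + 1 + 1) = - 1"
      using hst[of "Z 0"] hst[of "Z 0 + 1"] hZ o by (auto simp: add.commute odd_iff_mod_2_eq_one)
    then show False using hpos[of "Z 0 + 1 + 1"] Z0 by simp
  qed
  show "h (Z 0) = 0" using hZ e by simp
qed

text \<open>The counting function \<open>Z\<close> of the shortened runs splits into the word of the remaining runs and
  the doubled counting function of the runs that have vanished in pairs.\<close>
lemma split_level:
  assumes p: "0 < L - 2 * int n"
  shows "\<exists>Y' n' h' J m. level (L - 2 * int n) n' Y' h' \<and> mono J \<and>
    (0 < m \<longrightarrow> (\<forall>i. J (i + int m) = J i + (L - 2 * int n)) \<and> inflate Y' J = Y) \<and>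
    Op1 (run_ends 1 L Y) = run_ends 1 (L - 2 * int n) Y' + mset (map (\<lambda>i. J (int i)) [1..<m + 1]) \<and>
    Op2 (run_ends 0 L Y) = run_ends 0 (L - 2 * int n) Y' + mset (map (\<lambda>i. J (int i)) [1..<m + 1])"
proof -
  define P where "P = L - 2 * int n"
  have p: "0 < P" using p by (simp add: P_def)
  have n2: "0 < 2 * int n" using n0 by simp
  obtain Z where Z: "\<And>i x. i \<le> Z x \<longleftrightarrow> z i \<le> x"
    using counting_function_qp[OF z_mono p n2 z_period[folded P_def]] by metis
  have Zper: "Z (x + P) = Z x + 2 * int n" for x
  proof (rule int_ge_iff_eq)
    fix i show "i \<le> Z (x + P) \<longleftrightarrow> i \<le> Z x + 2 * int n"
      using Z[of i "x + P"] Z[of "i - 2 * int n" x] z_period[of "i - 2 * int n"] by (auto simp: P_def)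
  qed
  have Zm: "mono Z" using Z by (intro monoI) (meson order_refl order_trans)
  note fe = first_even[OF Z]
  obtain Y' n' where Y'0: "Y' 0 = 0" and st': "\<And>x. Y' (x + 1) = Y' x \<or> Y' (x + 1) = Y' x + 1"
    and par: "\<And>x. odd (Y' x) = odd (Z x)" and per': "\<And>x. Y' (x + P) = Y' x + 2 * int n'"
    using parity_lift[of "\<lambda>x. odd (Z x)" P] p fe Zper by auto
  have Y'm: "mono Y'" using st' by (intro int_step_mono) (metis order_refl zle_add1_eq_le less_le)
  define K where "K x = (Z x - Y' x) div 2" for x
  have ZK: "Z x = Y' x + 2 * K x" for x using par[of x] unfolding K_def by presburger
  have Km: "mono K"
  proof (rule int_step_mono)
    fix x show "K x \<le> K (x + 1)" using ZK[of x] ZK[of "x + 1"] st'[of x] monoD[OF Zm, of x "x + 1"] by auto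
  qed
  have Kper: "K (x + P) = K x + (int n - int n')" for x using ZK[of x] ZK[of "x + P"] Zper[of x] per'[of x] by linarith
  have "n' \<le> n" using Kper[of 0] monoD[OF Km, of 0 P] p by simp
  define m where "m = n - n'"
  have nm: "n = n' + m" "int n - int n' = int m" using \<open>n' \<le> n\<close> by (simp_all add: m_def)
  note Kper = Kper[unfolded nm(2)]
  \<comment> \<open>The bounds on \<open>K\<close> at 0 and at -1 place \<open>J 1\<close> to
    \<open>J m\<close> between 0 and \<open>P\<close> when \<open>m\<close> is positive; thus the
    labels \<open>1..m\<close> are exactly those listed by the algorithm.\<close>
  have K0: "0 \<le> K 0" using ZK[of 0] fe(1) Y'0 by simp
  have "Z (- 1) \<le> 0" using Z[of 1 "- 1"] z1 by linarith
  moreover have "- 1 \<le> Y' (- 1)" using st'[of "- 1"] Y'0 by auto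
  ultimately have K1: "K (- 1) \<le> 0" using ZK[of "- 1"] by linarith
  have "\<exists>J. mono J \<and> (0 < m \<longrightarrow> (\<forall>b x. b \<le> K x \<longleftrightarrow> J b \<le> x))"
  proof (cases "0 < m")
    case True
    then obtain J where J: "\<forall>b x. b \<le> K x \<longleftrightarrow> J b \<le> x"
      using sequence_of_counting_ex[OF Km _ p Kper] by auto
    then have "mono J" by (intro monoI) (meson order_refl order_trans)
    then show ?thesis using J by blast
  next
    case False
    \<comment> \<open>If no pair vanishes there is no rigging, and the zero function is a
      placeholder.\<close>
    then show ?thesis by (intro exI[of _ "\<lambda>_. 0"]) (simp add: mono_def)
  qed
  then obtain J where Jm: "mono J" and J: "\<And>b x. 0 < m \<Longrightarrow> b \<le> K x \<longleftrightarrow> J b \<le> x" by blast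
  have split: "mset (map (\<lambda>i. z (2 * int i - \<delta>)) [1..<n + 1]) =
      run_ends \<delta> P Y' + mset (map (\<lambda>i. J (int i)) [1..<m + 1])" if \<delta>: "\<delta> \<in> {0, 1}" for \<delta>
  proof (rule int_mset_eqI)
    fix x
    have 1: "size (filter_mset (\<lambda>z. z \<le> x) (mset (map (\<lambda>i. z (2 * int i - \<delta>)) [1..<n + 1]))) = min n (nat ((Z x + \<delta>) div 2))"
    proof (rule size_filter_le_enum)
      fix i show "z (2 * int i - \<delta>) \<le> x \<longleftrightarrow> int i \<le> (Z x + \<delta>) div 2"
        unfolding Z[symmetric] by presburger
    qed
    have 2: "size (filter_mset (\<lambda>z. z \<le> x) (mset (map (\<lambda>i. J (int i)) [1..<m + 1]))) = min m (nat (K x))"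
      by (rule size_filter_le_enum) (use J[of _ x] in simp)
    have 3: "int (size (filter_mset (\<lambda>y. y \<le> x) (run_ends \<delta> P Y'))) = (Y' (max 0 (min x P)) + \<delta>) div 2"
      by (rule size_run_ends_le[OF st' Y'0 \<delta>]) (use p in simp)
    have 4: "int (min n (nat ((Z x + \<delta>) div 2))) = (Y' (max 0 (min x P)) + \<delta>) div 2 + int (min m (nat (K x)))"
    proof -
      consider "x < 0" | "0 \<le> x" "x < P" | "P \<le> x" by linarith
      then show ?thesis
      proof cases
        case 1
        then have "Z x \<le> 0" "K x \<le> 0"
          using monoD[OF Zm, of x "- 1"] monoD[OF Km, of x "- 1"] K1 \<open>Z (- 1) \<le> 0\<close> by auto
        then show ?thesis using 1 \<delta> Y'0 p by auto
      next
        case 2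
        have "0 \<le> K x" using K0 monoD[OF Km 2(1)] by linarith
        moreover have "K x \<le> int m" using monoD[OF Km, of x "- 1 + P"] Kper[of "- 1"] K1 2 by simp
        moreover have "0 \<le> Y' x" using monoD[OF Y'm 2(1)] Y'0 by simp
        moreover have "Z x \<le> 2 * int n" using monoD[OF Zm, of x "- 1 + P"] Zper[of "- 1"] \<open>Z (- 1) \<le> 0\<close> 2 by simp
        ultimately show ?thesis using 2 ZK[of x] \<delta> by auto
      next
        case 3
        have "2 * int n \<le> Z x" using monoD[OF Zm 3] Zper[of 0] fe(1) by simp
        moreover have "int m \<le> K x" using monoD[OF Km 3] Kper[of 0] K0 by simp
        moreover have "Y' P = 2 * int n'" using per'[of 0] Y'0 by simp
        ultimately show ?thesis using 3 \<delta> p nm(1) by auto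
      qed
    qed
    show "size (filter_mset (\<lambda>y. y \<le> x) (mset (map (\<lambda>i. z (2 * int i - \<delta>)) [1..<n + 1]))) =
      size (filter_mset (\<lambda>y. y \<le> x) (run_ends \<delta> P Y' + mset (map (\<lambda>i. J (int i)) [1..<m + 1])))"
      unfolding filter_union_mset size_union 1 2 using 3 4 by linarith
  qed
  \<comment> \<open>Up to \<open>\<xi>\<close> shortening removes \<open>Z \<xi>\<close> letters,
    alternately 1 and 2. If their number is odd, one more 1 than 2 is lost, which the parity term
    corrects.\<close>
  define h' where "h' \<xi> = h (\<xi> + Z \<xi>) - Z \<xi> mod 2" for \<xi>
  have zZ: "z (Z \<xi>) \<le> \<xi>" "\<xi> < z (Z \<xi> + 1)" for \<xi> using Z[of "Z \<xi>" \<xi>] Z[of "Z \<xi> + 1" \<xi>] by auto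
  have YZ: "Y (\<xi> + Z \<xi>) = Z \<xi>" for \<xi> by (rule letter_at) (use zZ[of \<xi>] in auto)
  have lev': "level P n' Y' h'"
    unfolding level_def
  proof (intro conjI allI impI)
    show "h' 0 = 0" using fe by (simp add: h'_def)
    fix \<xi>
    have "h (\<xi> + 1 + Z (\<xi> + 1)) - Z (\<xi> + 1) mod 2 = h (\<xi> + 1 + Z \<xi>) - Z \<xi> mod 2"
    proof (rule height_vertical)
      show "Z \<xi> \<le> Z (\<xi> + 1)" using monoD[OF Zm] by simp
      fix i assume i: "Z \<xi> \<le> i" "i < Z (\<xi> + 1)"
      have "z (Z \<xi> + 1) \<le> z (i + 1)" using monoD[OF z_mono] i by simp
      then show "z i \<le> \<xi> + 1 \<and> \<xi> + 1 \<le> z (i + 1)" using zZ(2)[of \<xi>] Z[of i "\<xi> + 1"] i by auto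
    qed
    moreover have "\<xi> + 1 + Z \<xi> = \<xi> + Z \<xi> + 1" by simp
    ultimately show "h' (\<xi> + 1) = h' \<xi> + (if even (Y' \<xi>) then 1 else - 1)"
      using hst[of "\<xi> + Z \<xi>"] YZ[of \<xi>] par[of \<xi>] by (auto simp: h'_def)
    show "0 \<le> h' \<xi>" if "0 \<le> \<xi>"
    proof -
      \<comment> \<open>At an odd label the next letter is a 2, so the height there is at least 1
        and survives the correction.\<close>
      have "0 \<le> Z \<xi>" using fe(1) monoD[OF Zm that] by simp
      then show ?thesis
        using hpos[of "\<xi> + Z \<xi>"] hpos[of "\<xi> + Z \<xi> + 1"] hst[of "\<xi> + Z \<xi>"] YZ[of \<xi>] that
        by (cases "even (Z \<xi>)") (auto simp: h'_def odd_iff_mod_2_eq_one)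
    qed
  qed (use p st' per' Y'0 in auto)
  have "(\<forall>i. J (i + int m) = J i + P) \<and> inflate Y' J = Y" if m0: "0 < m"
  proof
    note J = J[OF m0]
    show "\<forall>i. J (i + int m) = J i + P"
    proof
      fix i show "J (i + int m) = J i + P"
      proof (rule int_le_iff_eq)
        fix x show "J (i + int m) \<le> x \<longleftrightarrow> J i + P \<le> x"
          using J[of "i + int m" x] J[of i "x - P"] Kper[of "x - P"] by auto
      qed
    qed
    show "inflate Y' J = Y"
    proof (rule inflate_eqY[OF Y'm Jm], rule int_le_iff_eq)
      fix i x
      have "merge_seq Y' J i \<le> x \<longleftrightarrow> i \<le> Y' x + 2 * K x"
        unfolding merge_seq_le[OF Y'm Jm] J[symmetric]
        by (meson add_left_mono mult_left_mono order_refl order_trans zero_le_numeral)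
      then show "merge_seq Y' J i \<le> x \<longleftrightarrow> z i \<le> x" using Z[of i x] ZK[of x] by simp
    qed
  qed
  then show ?thesis
    unfolding P_def[symmetric] Op1_run_ends Op2_run_ends using lev' Jm split[of 1] split[of 0] by blast
qed

text \<open>All runs have length one, so every shortened end collapses to 0 and the rigging is
  constant.\<close>

lemma full_level:
  assumes "L = 2 * int n"
  shows "Op1 (run_ends 1 L Y) = mset (map (\<lambda>i. 0) [1..<n + 1])" "Op2 (run_ends 0 L Y) = mset (map (\<lambda>i. 0) [1..<n + 1])"
    and "inflate (\<lambda>x. 0) (\<lambda>x. 0) = Y"
proof -
  have "z i = z 1" for i
    by (rule quasi_periodic_0_const[OF z_mono, of "2 * int n"]) (use n0 z_period assms in auto)
  moreover from this[of "2 * int n"] have "z 1 = 0" using z1 z2n assms by simp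
  ultimately have z: "z i = 0" for i by simp
  show "Op1 (run_ends 1 L Y) = mset (map (\<lambda>i. 0) [1..<n + 1])" "Op2 (run_ends 0 L Y) = mset (map (\<lambda>i. 0) [1..<n + 1])"
    unfolding Op1_run_ends Op2_run_ends z by simp_all
  show "inflate (\<lambda>x. 0) (\<lambda>x. 0) = Y"
    by (rule inflate_eqY) (use merge_seq_const[of "\<lambda>x. 0"] z in \<open>auto simp: mono_def\<close>)
qed

end

section \<open>Decoding the KKR map\<close>

lemma size_Op: "size (Op1 M) = size M" "size (Op2 M) = size M"
proof -
  have "length (sorted_list_of_multiset M) = size M" by (metis mset_sorted_list_of_multiset size_mset)
  then show "size (Op1 M) = size M" "size (Op2 M) = size M"
    by (simp_all add: Op1_def Op2_def del: upt_Suc)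
qed

lemma size_Ops: "size (fst ((Ops ^^ i) P)) = size (fst P)"
  by (induction i) (auto simp: Ops_def size_Op)

lemma kkr_size: "kkr A B recs \<Longrightarrow> size A = (\<Sum>r\<leftarrow>recs. size (fst r))"
proof (induction rule: kkr.induct)
  case (step A B i S recs)
  have "S \<subseteq># fst ((Ops ^^ i) (A, B))" using step.hyps(3) by simp
  then have "size S \<le> size A" "size (fst ((Ops ^^ i) (A, B)) - S) = size A - size S"
    using size_mset_mono[of S "fst ((Ops ^^ i) (A, B))"] size_Ops[of i "(A, B)"] by (auto simp: size_Diff_submset)
  then show ?case using step.IH by simp
qed simp

text \<open>Removing the intersection leaves disjoint multisets, so each record needs at least one
  further operation.\<close>

lemma kkr_pos: "kkr A B recs \<Longrightarrow> A \<inter># B = {#} \<Longrightarrow> r \<in> set recs \<Longrightarrow> 1 \<le> snd r"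
proof (induction arbitrary: r rule: kkr.induct)
  case (step A B i S recs)
  have "i \<noteq> 0" using step.hyps(3,4) step.prems(1) by (cases i) auto
  moreover have "(fst ((Ops ^^ i) (A, B)) - S) \<inter># (snd ((Ops ^^ i) (A, B)) - S) = {#}"
    unfolding step.hyps(3) by (rule multiset_eqI) auto
  ultimately show ?case using step.IH[of r] step.prems(2) by (cases "r = (S, i)") auto
qed simp

text \<open>Partial sums of positive numbers that exhaust \<open>1..N\<close> must increase by 1, so
  records and elimination levels correspond one to one.\<close>

lemma jpos_consecutive:
  assumes pos: "\<And>r. r \<in> set recs \<Longrightarrow> 1 \<le> snd r" and im: "jpos recs ` {..<length recs} = {1..N}"
  shows "length recs = N" "\<And>a. a < length recs \<Longrightarrow> jpos recs a = Suc a" "\<And>r. r \<in> set recs \<Longrightarrow> snd r = 1"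
proof -
  have J: "jpos recs (Suc a) = jpos recs a + snd (recs ! Suc a)" if "Suc a < length recs" for a
    using that by (simp add: jpos_def take_Suc_conv_app_nth)
  have J0: "jpos recs 0 = snd (recs ! 0)" if "0 < length recs"
    using that by (simp add: jpos_def take_Suc_conv_app_nth)
  have step: "jpos recs a + k \<le> jpos recs (a + k)" if "a + k < length recs" for a k
    using that
  proof (induction k)
    case (Suc k)
    then show ?case using J[of "a + k"] pos[OF nth_mem, of "Suc (a + k)"] by simp
  qed simp
  have inj: "inj_on (jpos recs) {..<length recs}"
  proof (rule linorder_inj_onI')
    fix i j assume "i \<in> {..<length recs}" "j \<in> {..<length recs}" "i < j"
    then show "jpos recs i \<noteq> jpos recs j" using step[of i "j - i"] by simp
  qed
  show len: "length recs = N" using card_image[OF inj] im by simp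
  have ge: "Suc a \<le> jpos recs a" if "a < length recs" for a
    using step[of 0 a] J0 pos[OF nth_mem, of 0] that by (cases "length recs") auto
  show eq: "jpos recs a = Suc a" if a: "a < length recs" for a
  proof -
    obtain k where k: "length recs = Suc (a + k)" using a less_imp_Suc_add by blast
    then have "jpos recs (a + k) \<in> jpos recs ` {..<length recs}" by (intro imageI) simp
    then have "jpos recs (a + k) \<in> {1..N}" unfolding im .
    then show ?thesis using step[of a k] ge[OF a] k len by simp
  qed
  show "snd r = 1" if r: "r \<in> set recs" for r
  proof -
    obtain a where a: "a < length recs" "r = recs ! a" using r unfolding in_set_conv_nth by blast
    show ?thesis
    proof (cases a)
      case 0
      then show ?thesis using J0 eq[OF a(1)] a(1) unfolding a(2) 0 by linarith
    next
      case (Suc b)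
      then have "b < length recs" "Suc b < length recs" using a(1) by simp_all
      then show ?thesis using J[of b] eq[of b] eq[of "Suc b"] unfolding a(2) Suc by linarith
    qed
  qed
qed

lemma kkr_empty: "kkr {#} {#} recs \<Longrightarrow> recs = []"
  by (erule kkr.cases) blast+

lemma Jext_enum:
  assumes "mono J" "\<And>i. J (i + int m) = J i + p" "0 < m"
  shows "Jext (sorted_list_of_multiset (mset (map (\<lambda>i. J (int i)) [1..<m + 1]))) p 0 = J"
proof
  fix i
  have s: "sorted_list_of_multiset (mset (map (\<lambda>i. J (int i)) [1..<m + 1])) = map (\<lambda>i. J (int i)) [1..<m + 1]"
    by (rule sorted_list_of_enum) (use monoD[OF assms(1)] in simp)
  have len: "length (map (\<lambda>i. J (int i)) [1..<m + 1]) = m" by (simp only: length_map length_upt diff_add_inverse2)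
  let ?r = "(i - 1) mod int m"
  have r: "0 \<le> ?r" "nat ?r < m" using assms(3) by (auto simp: nat_less_iff)
  have nth: "map (\<lambda>i. J (int i)) [1..<m + 1] ! nat ?r = J (1 + ?r)"
    using r assms(3) by (simp del: upt_Suc)
  have "J (1 + ?r + ((i - 1) div int m) * int m) = J (1 + ?r) + ((i - 1) div int m) * p"
    using quasi_periodic_multiple[of J "int m" p] assms(2) by blast
  moreover have "1 + ?r + ((i - 1) div int m) * int m = i" by simp
  ultimately show "Jext (sorted_list_of_multiset (mset (map (\<lambda>i. J (int i)) [1..<m + 1]))) p 0 i = J i"
    unfolding Jext_def s len Let_def nth by simp
qed

lemma level_0:
  assumes "level L n Y h" "run_ends 1 L Y = {#}" "run_ends 0 L Y = {#}"
  shows "Y = (\<lambda>x. 0)"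
proof -
  have lev: "\<And>x. Y (x + 1) = Y x \<or> Y (x + 1) = Y x + 1" "\<And>x. Y (x + L) = Y x + 2 * int n" "Y 0 = 0" "0 < L"
    using assms(1) by (auto simp: level_def)
  have "int (size (filter_mset (\<lambda>y. y \<le> L) (run_ends 1 L Y))) = (Y (max 0 (min L L)) + 1) div 2"
    by (rule size_run_ends_le[OF lev(1,3)]) (use lev(4) in auto)
  then have "n = 0" using assms(2) lev(2)[of 0] lev(3,4) by simp
  then have "Y x = Y 0" for x
    using quasi_periodic_0_const[of Y L x 0] lev int_step_mono[of Y]
    by (metis add.right_neutral mult_zero_right of_nat_0 order_refl zle_add1_eq_le less_le)
  then show ?thesis using lev(3) by auto
qed

lemma sum_list_map_nth: "(\<Sum>x\<leftarrow>xs. f x) = (\<Sum>a<length xs. f (xs ! a))"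
  by (simp add: sum_list_sum_nth atLeast0LessThan)

text \<open>A \<open>level\<close> of arbitrary length replaces the ballot path, so that the path
  left by one elimination is again an instance.\<close>

lemma kkr_decode:
  assumes "kkr A B recs" "A = run_ends 1 L Y" "B = run_ends 0 L Y" "level L n Y h"
    and "\<And>r. r \<in> set recs \<Longrightarrow> snd r = 1"
    and "\<And>a. a < length recs \<Longrightarrow> m (Suc a) = size (fst (recs ! a))"
    and "\<And>a. a < length recs \<Longrightarrow> J (Suc a) = Jext (rigs recs a) (vacancy L (length recs) m (Suc a)) 0"
  shows "Y = assemble (length recs) J"
  using assms
proof (induction arbitrary: L Y n h m J rule: kkr.induct)
  case finished
  then show ?case using level_0 by simp
next
  case (step A B i S recs)
  let ?p = "vacancy L (Suc (length recs)) m 1" and ?m = "\<lambda>k. m (Suc k)" and ?J = "\<lambda>k. J (Suc k)"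
  have i: "i = 1" using step.prems(4)[of "(S, i)"] by simp
  have S: "S = Op1 A \<inter># Op2 B" and rest: "kkr (Op1 A - S) (Op2 B - S) recs"
    using step.hyps(3,5) by (simp_all add: i Ops_def)
  have IH: "Y' = assemble (length recs) ?J"
    if "Op1 A - S = run_ends 1 ?p Y'" "Op2 B - S = run_ends 0 ?p Y'" "level ?p n' Y' h'" for Y' n' h'
  proof (rule step.IH)
    show "fst ((Ops ^^ i) (A, B)) - S = run_ends 1 ?p Y'" "snd ((Ops ^^ i) (A, B)) - S = run_ends 0 ?p Y'"
      "level ?p n' Y' h'" using that by (simp_all add: i Ops_def)
    show "snd r = 1" if "r \<in> set recs" for r using step.prems(4) that by simp
    fix a assume a: "a < length recs"
    show "m (Suc (Suc a)) = size (fst (recs ! a))" using step.prems(5)[of "Suc a"] a by simp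
    show "J (Suc (Suc a)) = Jext (rigs recs a) (vacancy ?p (length recs) ?m (Suc a)) 0"
      using step.prems(6)[of "Suc a"] a vacancy_Suc[of "Suc a" L "length recs" m] by (simp add: rigs_def)
  qed
  have J1: "J 1 = Jext (sorted_list_of_multiset S) ?p 0" using step.prems(6)[of 0] by (simp add: rigs_def)
  have n0: "0 < n"
  proof (rule ccontr)
    assume "\<not> 0 < n"
    then have "Y (x + L) = Y x" for x using step.prems(3) by (simp add: level_def)
    moreover have "mono Y" "0 < L" using step.prems(3)
      by (auto simp: level_def intro!: int_step_mono) (metis order_refl zle_add1_eq_le less_le)
    ultimately have "Y x = Y (x - 1)" for x using quasi_periodic_0_const[of Y L x "x - 1"] by simp
    then have "A = {#}" "B = {#}" using step.prems(1,2) by (auto simp: run_ends_def)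
    then show False using step.hyps(1) by simp
  qed
  have "mono Y" using step.prems(3)
    by (auto simp: level_def intro!: int_step_mono) (metis order_refl zle_add1_eq_le less_le)
  then obtain y where y: "\<And>i x. i \<le> Y x \<longleftrightarrow> y i \<le> x"
    using sequence_of_counting_ex[of Y "2 * int n" L] n0 step.prems(3) by (auto simp: level_def)
  interpret elimination L n Y h y "\<lambda>i. y i - i"
    by unfold_locales (rule step.prems(3) n0 y reflexive)+
  \<comment> \<open>The records together contain as many elements as the initial multiset, so the
    multiplicities add up to \<open>n\<close>.\<close>
  have pL: "?p = L - 2 * int n"
  proof -
    have "size A = n"
    proof -
      have "size (Op1 A) = n" unfolding step.prems(1) Op1_run_ends
        by (simp only: size_mset length_map length_upt diff_add_inverse2)
      then show ?thesis by (simp add: size_Op)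
    qed
    moreover have "size A = (\<Sum>r\<leftarrow>(S, i) # recs. size (fst r))"
      by (rule kkr_size, rule kkr.step) (use step.hyps in auto)
    moreover have "(\<Sum>k=1..length ((S, i) # recs). m k) = (\<Sum>r\<leftarrow>(S, i) # recs. size (fst r))"
    proof -
      have "(\<Sum>k=1..length ((S, i) # recs). m k) = (\<Sum>a<length ((S, i) # recs). m (Suc a))"
        by (rule sum.reindex_bij_witness[of _ Suc "\<lambda>k. k - 1"]) auto
      also have "\<dots> = (\<Sum>a<length ((S, i) # recs). size (fst (((S, i) # recs) ! a)))"
        by (rule sum.cong) (use step.prems(5) in auto)
      also have "\<dots> = (\<Sum>r\<leftarrow>(S, i) # recs. size (fst r))"
        by (rule sum_list_map_nth[symmetric])
      finally show ?thesis .
    qed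
    ultimately have "(\<Sum>k=1..Suc (length recs). m k) = n" by simp
    then have "(\<Sum>k=1..Suc (length recs). int (m k)) = int n" by (metis of_nat_sum)
    then show ?thesis unfolding vacancy_1 by simp
  qed
  show ?case
  proof (cases "0 < L - 2 * int n")
    case True
    obtain Y' n' h' J' m' where lev': "level (L - 2 * int n) n' Y' h'" and J'm: "mono J'"
      and J': "0 < m' \<Longrightarrow> (\<forall>i. J' (i + int m') = J' i + (L - 2 * int n)) \<and> inflate Y' J' = Y"
      and O: "Op1 A = run_ends 1 (L - 2 * int n) Y' + mset (map (\<lambda>i. J' (int i)) [1..<m' + 1])"
        "Op2 B = run_ends 0 (L - 2 * int n) Y' + mset (map (\<lambda>i. J' (int i)) [1..<m' + 1])"
      using split_level[OF True] unfolding step.prems(1,2) by blast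
    \<comment> \<open>The run ends of the surviving word are disjoint, so the intersection consists
      exactly of the vanished pairs.\<close>
    have "(X + M) \<inter># (X' + M) = (X \<inter># X') + M" for X X' M :: "int multiset"
      by (rule multiset_eqI) simp
    then have Se: "S = mset (map (\<lambda>i. J' (int i)) [1..<m' + 1])"
      unfolding S O by (simp only: run_ends_disjoint add_0)
    have m': "0 < m'" using step.hyps(4) Se by (cases m') auto
    have "J 1 = J'" unfolding J1 pL Se by (rule Jext_enum[OF J'm _ m']) (use J'[OF m'] in blast)
    moreover have "Y' = assemble (length recs) ?J"
      by (rule IH[of Y' n' h'], unfold pL) (use O lev' Se in \<open>simp_all del: upt_Suc\<close>)
    ultimately show ?thesis using J'[OF m'] by simp
  next
    case False
    then have L: "L = 2 * int n" using period_nonneg by simp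
    have O: "Op1 A = mset (map (\<lambda>i. (\<lambda>_. 0) (int i)) [1..<n + 1])" "Op2 B = mset (map (\<lambda>i. (\<lambda>_. 0) (int i)) [1..<n + 1])"
      using full_level(1,2)[OF L] step.prems(1,2) by simp_all
    have Se: "S = mset (map (\<lambda>i. (\<lambda>_. 0) (int i)) [1..<n + 1])" unfolding S O by (rule subset_mset.inf.idem)
    have "Op1 A - S = {#}" "Op2 B - S = {#}" unfolding O Se by (rule diff_cancel)+
    then have "recs = []" using rest kkr_empty by simp
    moreover have p0: "L - 2 * int n = 0" using L by simp
    have "J 1 = (\<lambda>x. 0)" unfolding J1 Se pL p0
      by (rule Jext_enum) (use n0 in \<open>auto simp: mono_def\<close>)
    ultimately show ?thesis using full_level(3)[OF L] by simp
  qed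
qed

lemma concat_guard: "concat (map (\<lambda>x. if P x then [f x] else []) xs) = map f (filter P xs)"
  by (induction xs) auto

lemma run_ends_word:
  assumes "\<And>j. 1 \<le> j \<Longrightarrow> j \<le> L \<Longrightarrow> P j \<longleftrightarrow> Y (int j) \<noteq> Y (int j - 1) \<and> even (Y (int j) + \<delta>)"
  shows "mset (map int (filter P [1..<L + 1])) = run_ends \<delta> (int L) Y"
proof -
  have "set (map int (filter P [1..<L + 1])) = {x \<in> {1..int L}. Y x \<noteq> Y (x - 1) \<and> even (Y x + \<delta>)}"
  proof (rule set_eqI)
    fix x
    show "x \<in> set (map int (filter P [1..<L + 1])) \<longleftrightarrow> x \<in> {x \<in> {1..int L}. Y x \<noteq> Y (x - 1) \<and> even (Y x + \<delta>)}"
    proof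
      assume "x \<in> set (map int (filter P [1..<L + 1]))"
      then obtain j where "x = int j" "P j" "1 \<le> j" "j \<le> L" by (auto simp del: upt_Suc)
      then show "x \<in> {x \<in> {1..int L}. Y x \<noteq> Y (x - 1) \<and> even (Y x + \<delta>)}" using assms by auto
    next
      assume x: "x \<in> {x \<in> {1..int L}. Y x \<noteq> Y (x - 1) \<and> even (Y x + \<delta>)}"
      then have "P (nat x)" "nat x \<in> set [1..<L + 1]" "x = int (nat x)" using assms[of "nat x"] by auto
      then show "x \<in> set (map int (filter P [1..<L + 1]))" 
        unfolding set_map by (intro image_eqI[of x int "nat x"]) (simp_all del: upt_Suc)
    qed
  qed
  moreover have "distinct (map int (filter P [1..<L + 1]))" by (simp add: distinct_map del: upt_Suc)
  ultimately show ?thesis unfolding run_ends_def by (metis mset_set_set)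
qed

lemma ballot_level:
  assumes L: "1 \<le> L" and b: "b \<in> paths L" "ballot b"
  shows "\<exists>Y n h. level (int L) n Y h \<and> b = word L Y \<and> M1 b = run_ends 1 (int L) Y \<and> M2 b = run_ends 0 (int L) Y"
proof -
  have len: "length b = L" and set: "set b \<subseteq> {1, 2}" using b(1) by (auto simp: paths_def)
  have nth: "b ! i = 1 \<or> b ! i = 2" if "i < L" for i
  proof -
    have "b ! i \<in> set b" using len that by simp
    then show ?thesis using set by blast
  qed
  define Q where "Q x \<longleftrightarrow> b ! nat (x mod int L) = 2" for x
  have "count_list (take (Suc 0) b) 2 \<le> count_list (take (Suc 0) b) 1" using b(2) len L by (simp add: ballot_def)
  then have "\<not> Q 0" using len L by (cases b) (auto simp: Q_def)
  moreover have "Q (x + int L) = Q x" for x by (simp add: Q_def)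
  ultimately obtain Y and n :: nat where Y0: "Y 0 = 0" and st: "\<And>x. Y (x + 1) = Y x \<or> Y (x + 1) = Y x + 1"
    and odd: "\<And>x. odd (Y x) = Q x" and per: "\<And>x. Y (x + int L) = Y x + 2 * int n"
    using parity_lift[of Q "int L"] L by auto
  have Qn: "Q (int i) \<longleftrightarrow> b ! i = 2" if "i < L" for i using that by (simp add: Q_def)
  obtain h :: "int \<Rightarrow> int" where h0: "h 0 = 0" and h: "\<And>x. h (x + 1) = h x + (if even (Y (x + 1 - 1)) then 1 else - 1)"
    using cumulative_ex[of "\<lambda>x. if even (Y (x - 1)) then 1 else - 1"] by blast
  then have h: "h (x + 1) = h x + (if even (Y x) then 1 else - 1)" for x by simp
  have hc: "h (int i) = int (count_list (take i b) 1) - int (count_list (take i b) 2)" if "i \<le> L" for i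
    using that
  proof (induction i)
    case (Suc i)
    have "take (Suc i) b = take i b @ [b ! i]" using Suc.prems len by (simp add: take_Suc_conv_app_nth)
    then show ?case using Suc h[of "int i"] odd[of "int i"] Qn[of i] nth[of i] by (auto simp: add.commute)
  qed (use h0 in simp)
  have hL: "0 \<le> h (int i)" if "i \<le> L" for i using b(2) hc[OF that] that len by (simp add: ballot_def)
  have "h (x + 1 + int L) - h (x + 1) = h (x + int L) - h x" for x
    using h[of x] h[of "x + int L"] per[of x] by (simp add: algebra_simps)
  then have hper: "h (x + int L) - h x = h (0 + int L) - h 0" for x by (rule int_step_const)
  \<comment> \<open>Each period adds \<open>h (int L)\<close>, which is nonnegative, so the ballot
    bound spreads from the first period to the half line.\<close>
  have hpos: "0 \<le> h x" if "0 \<le> x" for x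
  proof -
    have "h (x mod int L + (x div int L) * int L) = h (x mod int L) + (x div int L) * h (int L)"
      by (rule quasi_periodic_multiple) (use hper h0 in \<open>simp add: diff_eq_eq add.commute\<close>)
    moreover have "0 \<le> x mod int L" "x mod int L < int L" using L by simp_all
    then have "0 \<le> h (x mod int L)" using hL[of "nat (x mod int L)"] by (simp add: nat_le_iff)
    moreover have "0 \<le> (x div int L) * h (int L)"
      using hL[of L] that L by (intro mult_nonneg_nonneg) (auto simp: pos_imp_zdiv_nonneg_iff)
    ultimately show ?thesis by simp
  qed
  have lev: "level (int L) n Y h" unfolding level_def using L st per Y0 h0 h hpos by auto
  have w: "b = word L Y"
  proof (rule nth_equalityI)
    show "length b = length (word L Y)" using len by (simp add: word_def)
    fix i assume "i < length b"
    then show "b ! i = word L Y ! i" using len nth[of i] odd[of "int i"] Qn[of i] by (auto simp: word_def)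
  qed
  \<comment> \<open>Cell \<open>L\<close> carries the letter 1 in the periodic extension, in
    agreement with the convention \<open>b_(L+1) = 1\<close>.\<close>
  have YL: "even (Y (int L))" using per[of 0] Y0 by simp
  have lt: "letter b j = (if odd (Y (int j - 1)) then 2 else 1)" if "1 \<le> j" "j \<le> L + 1" for j
  proof (cases "j = L + 1")
    case True
    then show ?thesis using YL len by (simp add: letter_def)
  next
    case False
    then have "j - 1 < L" "int j - 1 = int (j - 1)" using that by auto
    then show ?thesis using that False len odd[of "int j - 1"] Qn[of "j - 1"] nth[of "j - 1"] by (auto simp: letter_def)
  qed
  have lt2: "letter b (j + 1) = (if odd (Y (int j)) then 2 else 1)" if "1 \<le> j" "j \<le> L" for j
    using lt[of "j + 1"] that by simp
  have flip: "Y (int j) \<noteq> Y (int j - 1) \<longleftrightarrow> odd (Y (int j)) \<noteq> odd (Y (int j - 1))" for j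
    using st[of "int j - 1"] by auto
  have "M1 b = run_ends 1 (int L) Y"
    unfolding M1_def concat_guard len by (rule run_ends_word) (use lt lt2 flip in \<open>auto split: if_splits\<close>)
  moreover have "M2 b = run_ends 0 (int L) Y"
    unfolding M2_def concat_guard len by (rule run_ends_word) (use lt lt2 flip in \<open>auto split: if_splits\<close>)
  ultimately show ?thesis using lev w by blast
qed

theorem mainTheorem10:
  fixes L N :: nat and m \<alpha> :: "nat \<Rightarrow> nat" and p :: "nat list"
  assumes "1 \<le> L"
    and "\<forall>j\<in>{1..N}. 0 < m j"
    and "p \<in> Palpha L N m \<alpha>"
  shows "\<exists>\<Phi>. bij_betw \<Phi> (orbit L N p) (torus L N m \<alpha>) \<and>
           (\<forall>q\<in>orbit L N p. \<forall>n\<in>ZN N.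
              \<Phi> (act L N n q) = tshift (\<lambda>j. \<Sum>k=1..N. n k * hvec N k j) (\<Phi> q))"
proof -
  have \<alpha>: "0 < \<alpha> j \<and> \<alpha> j dvd m j \<and> int (\<alpha> j) dvd vac L N m j" if "j \<in> {1..N}" for j
    using assms(3) that by (auto simp: Palpha_def)
  obtain d b recs where b: "b \<in> paths L" "ballot b" and p: "p = Tpow L 1 d b" and k: "kkr (M1 b) (M2 b) recs"
    and jp: "jpos recs ` {..<length recs} = {1..N}"
    and m: "\<And>a. a < length recs \<Longrightarrow> m (jpos recs a) = size (fst (recs ! a))"
    and J: "\<And>a. a < length recs \<Longrightarrow> Jext (rigs recs a) (vac L N m (jpos recs a)) d
             \<in> Jbar_alpha (\<alpha> (jpos recs a)) (m (jpos recs a)) (vac L N m (jpos recs a))"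
    using assms(3) unfolding Palpha_def by blast
  obtain Y n h where Y: "level (int L) n Y h" "b = word L Y" and M: "M1 b = run_ends 1 (int L) Y" "M2 b = run_ends 0 (int L) Y"
    using ballot_level[OF assms(1) b] by blast
  have "1 \<le> snd r" if "r \<in> set recs" for r
    using kkr_pos[OF k _ that] run_ends_disjoint unfolding M by blast
  note jc = jpos_consecutive[OF this jp]
  define J0 where "J0 j = Jext (rigs recs (j - 1)) (vac L N m j) 0" for j
  have Y0: "Y = assemble (length recs) J0"
    by (rule kkr_decode[OF k M Y(1) jc(3), of m]) (use m jc in \<open>simp_all add: J0_def vacancy_vac\<close>)
  have Jd: "(\<lambda>i. J0 j i + d) \<in> Jbar_alpha (\<alpha> j) (m j) (vac L N m j)" if "j \<in> {1..N}" for j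
  proof -
    have a: "j - 1 < length recs" "jpos recs (j - 1) = j" using that jc by auto
    have "(\<lambda>i. J0 j i + d) = Jext (rigs recs (j - 1)) (vac L N m j) d"
      by (simp add: J0_def Jext_def Let_def fun_eq_iff)
    then show ?thesis using J[OF a(1)] unfolding a(2) by simp
  qed
  have rd: "rigged (int L) N m (\<lambda>j i. J0 j i + d)"
    unfolding rigged_def
  proof
    fix j assume j: "j \<in> {1..N}"
    have "(\<lambda>i. J0 j i + d) \<in> Jbar (m j) (vac L N m j)" using Jbar_alpha_Jbar[OF Jd[OF j]] \<alpha>[OF j] by blast
    from Jbar_mono[OF this] this
    show "0 < m j \<and> mono (\<lambda>i. J0 j i + d) \<and> (\<forall>i. J0 j (i + int (m j)) + d = J0 j i + d + vacancy (int L) N m j)"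
      using assms(2) j by (simp add: Jbar_def vacancy_vac)
  qed
  then have r0: "rigged (int L) N m J0" using rigged_translate[OF rd, of "\<lambda>j. - d"] by simp
  have b0: "b = word L (assemble N J0)" using Y(2) Y0 jc(1) by simp
  \<comment> \<open>Since \<open>min j 1 = 1\<close> on all levels, the power \<open>d\<close> of
    the cyclic shift adds \<open>d\<close> to every rigging.\<close>
  have e: "assemble N (\<lambda>j i. J0 j i + d * int (min j 1)) = assemble N (\<lambda>j i. J0 j i + d)"
    by (rule assemble_cong) (simp add: min.absorb2)
  have pw: "p = word L (assemble N (\<lambda>j i. J0 j i + d))" "word L (assemble N (\<lambda>j i. J0 j i + d)) \<in> paths L"
    using Tpow_word[OF r0, of 1 d] b(1) unfolding p b0 e by auto
  show ?thesis
    unfolding pw(1) by (rule orbit_torus_bijection[OF _ rd pw(2) \<alpha> Jd]) (use assms(1) in auto)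
qed

end
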